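(* Let $w\in G(m,p,n)$ with $\ell_R(w)=\operatorname{codim}\operatorname{fix}(w)$. Suppose there is a set $S$ of cycles of $w$ whose weights sum to $0\pmod p$ but which cannot be partitioned into singletons $\{C\}$ with $C$ of weight $\equiv 0\pmod p$ and pairs of cycles whose weights sum to $0$ in $\mathbb Z/m\mathbb Z$. Then there exists $u\in[\mathrm{id},w]_{\mathrm{cdf}}$ with $u\notin[\mathrm{id},w]_{\ell_R}$.
   Context: Let $m,p,n$ be positive integers with $p\mid m$ and $\zeta=e^{2\pi i/m}$. The group $G(m,1,n)$ consists of pairs $w=[u;a]$ with $u\in\mathfrak S_n$ (the underlying permutation) and $a=(a_1,\dots,a_n)\in(\mathbb Z/m\mathbb Z)^n$ (the weights); $[u;a]$ is identified with the $n\times n$ monomial matrix having entry $\zeta^{a_i}$ in position $(u(i),i)$ and zeros elsewhere, the group law is matrix multiplication, and the group acts on $\mathbb C^n$. A cycle of $w$ is a cycle of $u$ (fixed points count as cycles of size $1$); $c(w)$ is the number of cycles of $w$ and $c_0(w)$ the number of cycles of weight $0$, where the weight of a set $I\subseteq[n]$ (e.g. the underlying set of a cycle) is $\sum_{i\in I}a_i\in\mathbb Z/m\mathbb Z$, and $\mathrm{wt}(w)=\sum_{i=1}^n a_i$. Since $p\mid m$, it makes sense to say an element of $\mathbb Z/m\mathbb Z$ is $\equiv 0\pmod p$. $G(m,p,n)=\{w\in G(m,1,n):\mathrm{wt}(w)\equiv 0\pmod p\}$. A reflection is an element $g$ whose fixed space $\operatorname{fix}(g)=\ker(g-1)\subseteq\mathbb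 C^n$ has codimension $1$; $R$ is the set of reflections of $G(m,p,n)$ (they generate the group). $\ell_R(g)$ is the minimum number of reflections whose product is $g$, and $\operatorname{codim}\operatorname{fix}(g)=n-\dim\operatorname{fix}(g)$. For $f\in\{\ell_R,\operatorname{codim}\operatorname{fix}\}$ define $x\le_f y$ iff $f(x)+f(x^{-1}y)=f(y)$ (a partial order), and $[\mathrm{id},w]_f=\{u: u\le_f w\}$; the subscript $\mathrm{cdf}$ means $f=\operatorname{codim}\operatorname{fix}$. *)

theory Defs
  imports "HOL-Analysis.Analysis" "HOL-Number_Theory.Cong"
begin

text \<open>Elements of G(m,1,n) are monomial n x n complex matrices; the index type 'n
  with CARD('n) = n plays the role of [n].  The pair [u;a] (u a permutation of
  the index type, a a weight vector with entries read modulo m) is the matrix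
  with entry zeta^(a j) at position (u j, j), where zeta = exp(2 pi i / m).\<close>

definition mono_mat :: "nat \<Rightarrow> ('n::finite \<Rightarrow> 'n) \<Rightarrow> ('n \<Rightarrow> int) \<Rightarrow> complex^'n^'n" where
  "mono_mat m u a = (\<chi> i j. if i = u j then cis (2 * pi * of_int (a j) / of_nat m) else 0)"

text \<open>weight of a set I of indices (an integer representing an element of Z/mZ)\<close>
definition wt_set :: "('n \<Rightarrow> int) \<Rightarrow> 'n set \<Rightarrow> int" where
  "wt_set a I = (\<Sum>i\<in>I. a i)"

text \<open>G(m,p,n): elements of G(m,1,n) whose total weight is 0 mod p\<close>
definition Gmpn :: "nat \<Rightarrow> nat \<Rightarrow> (complex^'n::finite^'n) set" where
  "Gmpn m p = {mono_mat m u a | u a. u permutes UNIV \<and> [wt_set a UNIV = 0] (mod int p)}"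

text \<open>fixed space and its codimension in C^n\<close>
definition fixsp :: "complex^'n::finite^'n \<Rightarrow> (complex^'n) set" where
  "fixsp g = {x. g *v x = x}"

definition codimfix :: "complex^'n::finite^'n \<Rightarrow> nat" where
  "codimfix g = CARD('n) - vec.dim (fixsp g)"

definition reflections :: "nat \<Rightarrow> nat \<Rightarrow> (complex^'n::finite^'n) set" where
  "reflections m p = {g \<in> Gmpn m p. codimfix g = 1}"

text \<open>reflection length: minimal number of reflections with product g\<close>
definition lenR :: "nat \<Rightarrow> nat \<Rightarrow> complex^'n::finite^'n \<Rightarrow> nat" where
  "lenR m p g = (LEAST k. \<exists>rs. length rs = k \<and> set rs \<subseteq> reflections m p \<and> foldr (**) rs (mat 1) = g)"

text \<open>x \<le>_f y iff f x + f (x^-1 y) = f y\<close>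
definition le_f :: "(complex^'n::finite^'n \<Rightarrow> nat) \<Rightarrow> complex^'n^'n \<Rightarrow> complex^'n^'n \<Rightarrow> bool" where
  "le_f f x y \<longleftrightarrow> f x + f (matrix_inv x ** y) = f y"

text \<open>[id,w]_f, as a subset of the group G(m,p,n)\<close>
definition interval_f :: "nat \<Rightarrow> nat \<Rightarrow> (complex^'n::finite^'n \<Rightarrow> nat) \<Rightarrow> complex^'n^'n \<Rightarrow> (complex^'n^'n) set" where
  "interval_f m p f w = {x \<in> Gmpn m p. le_f f x w}"

text \<open>cycles of the permutation u (underlying sets), fixed points included\<close>
definition cycles_of :: "('n \<Rightarrow> 'n) \<Rightarrow> 'n set set" where
  "cycles_of u = {{(u ^^ k) i | k. True} | i. True}"

text \<open>P is a partition of S into singletons {C} with wt C = 0 mod p and pairs {C,D}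
  (C \<noteq> D) with wt C + wt D = 0 in Z/mZ\<close>
definition good_partition :: "nat \<Rightarrow> nat \<Rightarrow> ('n \<Rightarrow> int) \<Rightarrow> 'n set set \<Rightarrow> 'n set set set \<Rightarrow> bool" where
  "good_partition m p a S P \<longleftrightarrow>
     \<Union>P = S \<and> (\<forall>B\<in>P. \<forall>B'\<in>P. B \<noteq> B' \<longrightarrow> B \<inter> B' = {}) \<and>
     (\<forall>B\<in>P. (\<exists>C. B = {C} \<and> [wt_set a C = 0] (mod int p)) \<or>
             (\<exists>C D. C \<noteq> D \<and> B = {C, D} \<and> [wt_set a C + wt_set a D = 0] (mod int m)))"

end

theory Submission
  imports Defs "HOL-Combinatorics.Orbits" "HOL-Library.Disjoint_Sets"
begin

text \<open>Write w = [u;a], let T be the cycles in S whose weight is not 0 mod m, and let A be their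
  union. The element x that agrees with w on A and is the identity elsewhere lies in G(m,p,n),
  because the remaining cycles of S have weight 0 mod m. The fixed spaces of x and y = x^-1 w are
  complementary with intersection fix(w), so x <=_cdf w, while codim fix(x) <= |A|.

  Along a factorisation of [v;b] into reflections one maintains a partition of [n] into v-stable
  blocks of weight 0 mod p such that n + c(v) is at most the number of reflections plus the
  value of the partition, where a block counts 2 if its weight is 0 mod m and 1 otherwise. For x,
  whose cycles are those of T and the points outside A, the value is at most |T| + 2(n - |A|),
  with equality only if each block meeting A contains one cycle of T, or two whose weights add up
  to 0 mod m; together with the singletons of the other cycles of S this would be a partition of S
  that the hypothesis excludes. Hence l_R(x) > |A| >= codim fix(x), and x <=_{l_R} w would give
  l_R(w) = l_R(x) + l_R(y) > codim fix(x) + codim fix(y) = codim fix(w), contrary to the hypothesis.\<close>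

section \<open>Monomial matrices\<close>

abbreviation unit_root :: "nat \<Rightarrow> int \<Rightarrow> complex" where
  "unit_root m t \<equiv> cis (2 * pi * of_int t / of_nat m)"

lemma unit_root_add: "unit_root m s * unit_root m t = unit_root m (s + t)"
  by (simp add: cis_mult add_divide_distrib distrib_left)

lemma unit_root_eq_1_iff:
  assumes "0 < m" shows "unit_root m t = 1 \<longleftrightarrow> int m dvd t"
proof
  assume "int m dvd t"
  then obtain k where "t = int m * k" by (auto elim: dvdE)
  then have "2 * pi * of_int t / of_nat m = 2 * pi * of_int k" using assms by simp
  then show "unit_root m t = 1" by simp
next
  assume "unit_root m t = 1"
  then have "exp (\<i> * complex_of_real (2 * pi * of_int t / of_nat m)) = 1"
    by (simp add: cis_conv_exp mult.commute)
  then obtain k :: int where "2 * pi * of_int t / of_nat m = 2 * pi * of_int k"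
    by (auto simp: exp_eq_1 Ints_def)
  then have "of_int t = real m * of_int k" using assms by (simp add: field_simps)
  then have "t = int m * k" by (metis of_int_eq_iff of_int_mult of_int_of_nat_eq)
  then show "int m dvd t" by simp
qed

lemma unit_root_eq_iff:
  assumes "0 < m" shows "unit_root m s = unit_root m t \<longleftrightarrow> [s = t] (mod int m)"
proof -
  have "unit_root m s = unit_root m (s - t) * unit_root m t"
    by (simp only: unit_root_add diff_add_cancel)
  then have "unit_root m s = unit_root m t \<longleftrightarrow> unit_root m (s - t) = 1"
    by (metis mult_cancel_right2 cis_neq_zero mult_1_left)
  then show ?thesis
    using unit_root_eq_1_iff[OF assms, of "s - t"] by (simp only: cong_iff_dvd_diff)
qed

lemma unit_root_eq_1_cong_iff:
  assumes "0 < m" shows "unit_root m t = 1 \<longleftrightarrow> [t = 0] (mod int m)"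
  using unit_root_eq_iff[OF assms, of t 0] by simp

lemma mono_mat_mult:
  "mono_mat m u a ** mono_mat m v b = mono_mat m (u \<circ> v) (\<lambda>j. a (v j) + b j)"
proof -
  have "(\<Sum>k\<in>UNIV. (if i = u k then unit_root m (a k) else 0) * (if k = v j then unit_root m (b j) else 0))
        = (if i = u (v j) then unit_root m (a (v j) + b j) else 0)" for i j
  proof -
    have "(\<Sum>k\<in>UNIV. (if i = u k then unit_root m (a k) else 0) * (if k = v j then unit_root m (b j) else 0))
        = (\<Sum>k\<in>UNIV. if k = v j then (if i = u k then unit_root m (a k) else 0) * unit_root m (b j) else 0)"
      by (rule sum.cong) auto
    also have "\<dots> = (if i = u (v j) then unit_root m (a (v j)) else 0) * unit_root m (b j)"
      by (simp add: sum.delta)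
    finally show ?thesis by (simp add: unit_root_add)
  qed
  then show ?thesis
    by (simp add: matrix_matrix_mult_def mono_mat_def vec_eq_iff)
qed

lemma mono_mat_id: "mono_mat m id (\<lambda>_. 0) = mat 1"
  by (simp add: mono_mat_def mat_def vec_eq_iff)

lemma mono_mat_cong:
  assumes "0 < m" "\<And>j. [a j = b j] (mod int m)"
  shows "mono_mat m u a = mono_mat m u b"
  using assms by (simp add: mono_mat_def vec_eq_iff unit_root_eq_iff)

lemma mono_mat_inj:
  assumes "0 < m" "mono_mat m u a = mono_mat m v b"
  shows "u = v" "\<And>j. [a j = b j] (mod int m)"
proof -
  have entry: "mono_mat m u a $ u j $ j = mono_mat m v b $ u j $ j" for j
    using assms(2) by simp
  show uv: "u = v"
  proof
    fix j show "u j = v j" using entry[of j] by (simp add: mono_mat_def split: if_splits)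
  qed
  fix j show "[a j = b j] (mod int m)"
    using entry[of j] uv by (simp add: mono_mat_def unit_root_eq_iff[OF assms(1)])
qed

lemma mono_mat_mult_vec:
  assumes "bij u"
  shows "(mono_mat m u a *v x) $ i = unit_root m (a (inv u i)) * x $ (inv u i)"
proof -
  have "(mono_mat m u a *v x) $ i = (\<Sum>j\<in>UNIV. (if i = u j then unit_root m (a j) else 0) * x $ j)"
    by (simp add: matrix_vector_mult_def mono_mat_def)
  also have "\<dots> = (\<Sum>j\<in>UNIV. if j = inv u i then unit_root m (a j) * x $ j else 0)"
    by (rule sum.cong) (use assms in \<open>auto simp: bij_inv_eq_iff\<close>)
  also have "\<dots> = unit_root m (a (inv u i)) * x $ (inv u i)" by (simp add: sum.delta)
  finally show ?thesis .
qed

lemma fixsp_mono_mat_iff: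
  assumes "bij u"
  shows "x \<in> fixsp (mono_mat m u a) \<longleftrightarrow> (\<forall>k. x $ u k = unit_root m (a k) * x $ k)"
proof -
  have "x \<in> fixsp (mono_mat m u a) \<longleftrightarrow> (\<forall>i. unit_root m (a (inv u i)) * x $ inv u i = x $ i)"
    by (simp add: fixsp_def vec_eq_iff mono_mat_mult_vec[OF assms])
  also have "\<dots> \<longleftrightarrow> (\<forall>k. unit_root m (a k) * x $ k = x $ u k)"
    using assms by (metis bij_inv_eq_iff)
  finally show ?thesis by auto
qed

definition inv_weights :: "('n \<Rightarrow> 'n) \<Rightarrow> ('n \<Rightarrow> int) \<Rightarrow> 'n \<Rightarrow> int" where
  "inv_weights u a = (\<lambda>j. - a (inv u j))"

lemma mono_mat_inv_left:
  assumes "bij u"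
  shows "mono_mat m (inv u) (inv_weights u a) ** mono_mat m u a = mat 1"
proof -
  have "inv u \<circ> u = id" using assms by (simp add: bij_is_inj)
  moreover have "(\<lambda>j. inv_weights u a (u j) + a j) = (\<lambda>_. 0)"
    using assms by (simp add: inv_weights_def bij_is_inj)
  ultimately show ?thesis by (simp add: mono_mat_mult mono_mat_id)
qed

lemma mono_mat_inv_right:
  assumes "bij u"
  shows "mono_mat m u a ** mono_mat m (inv u) (inv_weights u a) = mat 1"
proof -
  have "u \<circ> inv u = id" using assms by (metis bij_def surj_iff)
  moreover have "(\<lambda>j. a (inv u j) + inv_weights u a j) = (\<lambda>_. 0)" by (simp add: inv_weights_def)
  ultimately show ?thesis by (simp add: mono_mat_mult mono_mat_id)
qed

lemma matrix_inv_eqI: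
  fixes A B :: "'a::comm_ring_1^'n::finite^'n"
  assumes "A ** B = mat 1" "B ** A = mat 1"
  shows "matrix_inv A = B"
proof -
  define C where "C = matrix_inv A"
  have CA: "C ** A = mat 1"
    using someI_ex[of "\<lambda>C. A ** C = mat 1 \<and> C ** A = mat 1"] assms
    by (auto simp: C_def matrix_inv_def)
  have "C = C ** (A ** B)" by (simp add: assms)
  also have "\<dots> = B" by (simp add: matrix_mul_assoc CA)
  finally show ?thesis by (simp add: C_def)
qed

lemma matrix_inv_mono_mat:
  assumes "bij u"
  shows "matrix_inv (mono_mat m u a) = mono_mat m (inv u) (inv_weights u a)"
  by (rule matrix_inv_eqI[OF mono_mat_inv_right[OF assms] mono_mat_inv_left[OF assms]])

lemma Gmpn_I: "u permutes UNIV \<Longrightarrow> [wt_set a UNIV = 0] (mod int p) \<Longrightarrow> mono_mat m u a \<in> Gmpn m p"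
  unfolding Gmpn_def by blast

lemma Gmpn_wt_set_dvd:
  assumes "0 < m" "p dvd m" "mono_mat m u a \<in> Gmpn m p"
  shows "int p dvd wt_set a UNIV"
proof -
  obtain u' a' where ua': "mono_mat m u a = mono_mat m u' a'" "[wt_set a' UNIV = 0] (mod int p)"
    using assms(3) unfolding Gmpn_def by blast
  have "[wt_set a UNIV = wt_set a' UNIV] (mod int m)"
    unfolding wt_set_def by (rule cong_sum) (rule mono_mat_inj(2)[OF assms(1) ua'(1)])
  then have "[wt_set a UNIV = wt_set a' UNIV] (mod int p)"
    by (rule cong_dvd_modulus) (use assms(2) in simp)
  then show ?thesis using ua'(2) by (metis cong_0_iff cong_trans)
qed

section \<open>Codimension of fixed spaces\<close>

lemma subspace_fixsp: "vec.subspace (fixsp (g::complex^'n::finite^'n))"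
  unfolding vec.subspace_def fixsp_def
  by (auto simp: matrix_vector_right_distrib vec.scale)

lemma dim_le_card: "vec.dim (W::(complex^'n::finite) set) \<le> CARD('n)"
  by (rule dim_subset_UNIV_cart_gen)

lemma codimfix_mat_1: "codimfix (mat 1 :: complex^'n::finite^'n) = 0"
proof -
  have "fixsp (mat 1 :: complex^'n^'n) = UNIV" by (simp add: fixsp_def)
  then show ?thesis using vec_dim_card[where 'a=complex and 'n='n] by (simp only: codimfix_def)
qed

lemma codimfix_mult_le:
  fixes g h :: "complex^'n::finite^'n"
  shows "codimfix (g ** h) \<le> codimfix g + codimfix h"
proof -
  let ?U = "fixsp g" and ?V = "fixsp h"
  have "vec.dim {x + y |x y. x \<in> ?U \<and> y \<in> ?V} + vec.dim (?U \<inter> ?V) = vec.dim ?U + vec.dim ?V"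
    by (rule vec.dim_sums_Int[OF subspace_fixsp subspace_fixsp])
  moreover have "?U \<inter> ?V \<subseteq> fixsp (g ** h)"
    by (auto simp: fixsp_def matrix_vector_mul_assoc[symmetric])
  then have "vec.dim (?U \<inter> ?V) \<le> vec.dim (fixsp (g ** h))" by (rule vec.dim_subset)
  ultimately show ?thesis
    using dim_le_card[of "{x + y |x y. x \<in> ?U \<and> y \<in> ?V}"] dim_le_card[of ?U] dim_le_card[of ?V]
    by (simp add: codimfix_def)
qed

lemma card_le_codimfix:
  fixes g :: "complex^'n::finite^'n"
  assumes "\<And>x. x \<in> fixsp g \<Longrightarrow> \<forall>i. i \<notin> X \<longrightarrow> x $ i = 0 \<Longrightarrow> \<forall>i\<in>X. x $ i = 0"
  shows "card X \<le> codimfix g"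
proof -
  let ?E = "{x. \<forall>i. i \<notin> X \<longrightarrow> x $ i = 0} :: (complex^'n) set"
  have "vec.subspace ?E" unfolding vec.subspace_def by auto
  then have "vec.dim {x + y |x y. x \<in> fixsp g \<and> y \<in> ?E} + vec.dim (fixsp g \<inter> ?E)
      = vec.dim (fixsp g) + vec.dim ?E"
    by (rule vec.dim_sums_Int[OF subspace_fixsp])
  moreover have "fixsp g \<inter> ?E \<subseteq> {0}"
  proof
    fix x assume x: "x \<in> fixsp g \<inter> ?E"
    have "x $ i = 0" for i using assms[of x] x by (cases "i \<in> X") auto
    then show "x \<in> {0}" by (simp add: vec_eq_iff)
  qed
  then have "vec.dim (fixsp g \<inter> ?E) = 0" by simp
  moreover have "vec.dim ?E = card X" by (rule dim_substandard_cart)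
  ultimately show ?thesis
    using dim_le_card[of "{x + y |x y. x \<in> fixsp g \<and> y \<in> ?E}"] by (simp add: codimfix_def)
qed

lemma codimfix_eq_card:
  fixes g :: "complex^'n::finite^'n"
  assumes "\<And>x. x \<in> fixsp g \<Longrightarrow> \<forall>i. i \<notin> X \<longrightarrow> x $ i = 0 \<Longrightarrow> \<forall>i\<in>X. x $ i = 0"
    and "\<And>x. \<exists>y z. y \<in> fixsp g \<and> (\<forall>i. i \<notin> X \<longrightarrow> z $ i = 0) \<and> x = y + z"
  shows "codimfix g = card X"
proof -
  let ?E = "{x. \<forall>i. i \<notin> X \<longrightarrow> x $ i = 0} :: (complex^'n) set"
  have "vec.subspace ?E" unfolding vec.subspace_def by auto
  then have "vec.dim {x + y |x y. x \<in> fixsp g \<and> y \<in> ?E} + vec.dim (fixsp g \<inter> ?E)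
      = vec.dim (fixsp g) + vec.dim ?E"
    by (rule vec.dim_sums_Int[OF subspace_fixsp])
  moreover have "{x + y |x y. x \<in> fixsp g \<and> y \<in> ?E} = UNIV" using assms(2) by blast
  moreover have "fixsp g \<inter> ?E \<subseteq> {0}"
  proof
    fix x assume x: "x \<in> fixsp g \<inter> ?E"
    have "x $ i = 0" for i using assms(1)[of x] x by (cases "i \<in> X") auto
    then show "x \<in> {0}" by (simp add: vec_eq_iff)
  qed
  then have "vec.dim (fixsp g \<inter> ?E) = 0" by simp
  moreover have "vec.dim ?E = card X" by (rule dim_substandard_cart)
  ultimately show ?thesis
    using vec_dim_card[where 'a=complex and 'n='n] by (simp add: codimfix_def)
qed

lemma codimfix_le_card:
  fixes g :: "complex^'n::finite^'n"
  assumes "\<And>x. \<forall>i\<in>X. x $ i = 0 \<Longrightarrow> g *v x = x"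
  shows "codimfix g \<le> card X"
proof -
  let ?E = "{x. \<forall>i. i \<notin> - X \<longrightarrow> x $ i = 0} :: (complex^'n) set"
  have "?E \<subseteq> fixsp g" using assms by (auto simp: fixsp_def)
  then have "vec.dim ?E \<le> vec.dim (fixsp g)" by (rule vec.dim_subset)
  then have "card (- X) \<le> vec.dim (fixsp g)" by (simp only: dim_substandard_cart)
  moreover have "card (- X) = CARD('n) - card X"
    by (metis Compl_eq_Diff_UNIV card_Diff_subset finite top_greatest)
  ultimately show ?thesis by (simp add: codimfix_def)
qed

lemma codimfix_eq_add:
  fixes g h k :: "complex^'n::finite^'n"
  assumes "fixsp g = fixsp h \<inter> fixsp k"
    and "\<And>x. \<exists>y z. y \<in> fixsp h \<and> z \<in> fixsp k \<and> x = y + z"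
  shows "codimfix g = codimfix h + codimfix k"
proof -
  have "vec.dim {y + z |y z. y \<in> fixsp h \<and> z \<in> fixsp k} + vec.dim (fixsp h \<inter> fixsp k)
      = vec.dim (fixsp h) + vec.dim (fixsp k)"
    by (rule vec.dim_sums_Int[OF subspace_fixsp subspace_fixsp])
  moreover have "{y + z |y z. y \<in> fixsp h \<and> z \<in> fixsp k} = UNIV" using assms(2) by blast
  ultimately show ?thesis
    using assms(1) dim_le_card[of "fixsp h"] dim_le_card[of "fixsp k"]
      vec_dim_card[where 'a=complex and 'n='n]
    by (simp add: codimfix_def)
qed

lemma two_le_codimfix:
  fixes g :: "complex^'n::finite^'n"
  assumes "i \<noteq> j" "\<And>x. x \<in> fixsp g \<Longrightarrow> \<forall>l. l \<noteq> i \<and> l \<noteq> j \<longrightarrow> x $ l = 0 \<Longrightarrow> x $ i = 0 \<and> x $ j = 0"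
  shows "2 \<le> codimfix g"
proof -
  have "card {i, j} \<le> codimfix g"
  proof (rule card_le_codimfix)
    fix x assume "x \<in> fixsp g" "\<forall>l. l \<notin> {i, j} \<longrightarrow> x $ l = 0"
    then show "\<forall>l\<in>{i, j}. x $ l = 0" using assms(2) by simp
  qed
  then show ?thesis using assms(1) by simp
qed

section \<open>Reflections of G(m,p,n)\<close>

lemma eq_unit_root_mult_self_imp_zero:
  assumes "0 < m" "x = unit_root m t * x" "\<not> [t = 0] (mod int m)"
  shows "x = 0"
proof -
  have "unit_root m t \<noteq> 1" using assms(1,3) unit_root_eq_1_cong_iff by blast
  then show ?thesis using assms(2) mult_cancel_right2[of "unit_root m t" x] by simp
qed

lemma reflection_perm_cases:
  fixes s :: "'n::finite \<Rightarrow> 'n"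
  assumes s: "bij s" and codim: "codimfix (mono_mat m s c) = 1"
  shows "s = id \<or> (\<exists>i j. i \<noteq> j \<and> s = Transposition.transpose i j)"
proof (rule ccontr)
  assume contra: "\<not> ?thesis"
  have F: "x $ s k = unit_root m (c k) * x $ k" if "x \<in> fixsp (mono_mat m s c)" for x k
    using that fixsp_mono_mat_iff[OF s] by blast
  have inj: "s x = s y \<longleftrightarrow> x = y" for x y using s by (simp add: bij_is_inj inj_eq)
  obtain k where k: "s k \<noteq> k" using contra by (metis eq_id_iff)
  have "2 \<le> codimfix (mono_mat m s c)"
  proof (cases "s (s k) = k")
    case False
    show ?thesis
    proof (rule two_le_codimfix)
      show "s k \<noteq> s (s k)" using k inj by simp
      fix x assume x: "x \<in> fixsp (mono_mat m s c)" "\<forall>l. l \<noteq> s k \<and> l \<noteq> s (s k) \<longrightarrow> x $ l = 0"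
      have "x $ k = 0" using x(2) k False by auto
      then have "x $ s k = 0" using F[OF x(1), of k] by simp
      moreover from this have "x $ s (s k) = 0" using F[OF x(1), of "s k"] by simp
      ultimately show "x $ s k = 0 \<and> x $ s (s k) = 0" by simp
    qed
  next
    case True
    have "s \<noteq> Transposition.transpose k (s k)" using contra k by metis
    then obtain k' where k'_moved: "s k' \<noteq> Transposition.transpose k (s k) k'" by (meson ext)
    have k': "k' \<noteq> k" "k' \<noteq> s k" using k'_moved True by auto
    then have "s k' \<noteq> k'" using k'_moved by simp
    show ?thesis
    proof (rule two_le_codimfix)
      show "s k \<noteq> s k'" using k'(1) inj by simp
      fix x assume x: "x \<in> fixsp (mono_mat m s c)" "\<forall>l. l \<noteq> s k \<and> l \<noteq> s k' \<longrightarrow> x $ l = 0"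
      have "k \<noteq> s k'" using True k'(2) inj by metis
      then have "x $ k = 0" using x(2) k by auto
      moreover have "x $ k' = 0" using x(2) k' \<open>s k' \<noteq> k'\<close> by auto
      ultimately show "x $ s k = 0 \<and> x $ s k' = 0" using F[OF x(1), of k] F[OF x(1), of k'] by simp
    qed
  qed
  then show False using codim by simp
qed

lemma reflection_diagonal_weights:
  fixes c :: "'n::finite \<Rightarrow> int"
  assumes m: "0 < m" and codim: "codimfix (mono_mat m id c) = 1"
  shows "\<exists>j. \<forall>l. l \<noteq> j \<longrightarrow> [c l = 0] (mod int m)"
proof (rule ccontr)
  assume "\<not> ?thesis"
  then obtain i j where ij: "i \<noteq> j" "\<not> [c i = 0] (mod int m)" "\<not> [c j = 0] (mod int m)"
    by metis
  have "2 \<le> codimfix (mono_mat m id c)"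
  proof (rule two_le_codimfix[OF ij(1)])
    fix x assume "x \<in> fixsp (mono_mat m id c)"
    then have "x $ l = unit_root m (c l) * x $ l" for l
      by (simp only: fixsp_mono_mat_iff[OF bij_id] id_apply)
    then show "x $ i = 0 \<and> x $ j = 0"
      using ij eq_unit_root_mult_self_imp_zero[OF m] by blast
  qed
  then show False using codim by simp
qed

lemma reflection_transposition_weights:
  fixes c :: "'n::finite \<Rightarrow> int"
  assumes m: "0 < m" and ij: "i \<noteq> j"
    and codim: "codimfix (mono_mat m (Transposition.transpose i j) c) = 1"
  shows "\<forall>l. l \<noteq> i \<longrightarrow> l \<noteq> j \<longrightarrow> [c l = 0] (mod int m)"
    and "[c i + c j = 0] (mod int m)"
proof -
  let ?g = "mono_mat m (Transposition.transpose i j) c"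
  have F: "x $ Transposition.transpose i j k = unit_root m (c k) * x $ k" if "x \<in> fixsp ?g" for x k
    using that fixsp_mono_mat_iff[of "Transposition.transpose i j"] by simp
  show "\<forall>l. l \<noteq> i \<longrightarrow> l \<noteq> j \<longrightarrow> [c l = 0] (mod int m)"
  proof (intro allI impI, rule ccontr)
    fix l assume l: "l \<noteq> i" "l \<noteq> j" "\<not> [c l = 0] (mod int m)"
    have "2 \<le> codimfix ?g"
    proof (rule two_le_codimfix)
      show "j \<noteq> l" using l by simp
      fix x assume x: "x \<in> fixsp ?g" "\<forall>k. k \<noteq> j \<and> k \<noteq> l \<longrightarrow> x $ k = 0"
      have "x $ i = 0" using x(2) ij l(1) by auto
      then have "x $ j = 0" using F[OF x(1), of i] by simp
      moreover have "x $ l = 0"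
        using F[OF x(1), of l] l eq_unit_root_mult_self_imp_zero[OF m] by simp
      ultimately show "x $ j = 0 \<and> x $ l = 0" by simp
    qed
    then show False using codim by simp
  qed
  show "[c i + c j = 0] (mod int m)"
  proof (rule ccontr)
    assume nz: "\<not> [c i + c j = 0] (mod int m)"
    have "2 \<le> codimfix ?g"
    proof (rule two_le_codimfix[OF ij])
      fix x assume x: "x \<in> fixsp ?g"
      have xj: "x $ j = unit_root m (c i) * x $ i" using F[OF x, of i] by simp
      have "x $ i = unit_root m (c j) * x $ j" using F[OF x, of j] by simp
      \<comment> \<open>going once around the 2-cycle multiplies x $ i by the root of unity of weight c i + c j\<close>
      then have "x $ i = unit_root m (c j + c i) * x $ i"
        by (simp only: xj mult.assoc[symmetric] unit_root_add)
      moreover have "\<not> [c j + c i = 0] (mod int m)" using nz by (simp add: add.commute)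
      ultimately have "x $ i = 0" by (rule eq_unit_root_mult_self_imp_zero[OF m])
      then show "x $ i = 0 \<and> x $ j = 0" using xj by simp
    qed
    then show False using codim by simp
  qed
qed

lemma reflection_diagonal:
  fixes j :: "'n::finite"
  assumes m: "0 < m" and t: "[t = 0] (mod int p)" "\<not> [t = 0] (mod int m)"
  shows "mono_mat m id (\<lambda>l. if l = j then t else 0) \<in> reflections m p"
proof -
  let ?c = "\<lambda>l. if l = j then t else 0"
  have F: "x \<in> fixsp (mono_mat m id ?c) \<longleftrightarrow> x $ j = unit_root m t * x $ j" for x
  proof -
    have "x \<in> fixsp (mono_mat m id ?c) \<longleftrightarrow> (\<forall>k. x $ k = unit_root m (?c k) * x $ k)"
      by (simp only: fixsp_mono_mat_iff[OF bij_id] id_apply)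
    then show ?thesis by auto
  qed
  have "codimfix (mono_mat m id ?c) = card {j}"
  proof (rule codimfix_eq_card)
    fix x assume "x \<in> fixsp (mono_mat m id ?c)"
    then show "\<forall>i\<in>{j}. x $ i = 0"
      using F t(2) eq_unit_root_mult_self_imp_zero[OF m] by blast
  next
    fix x :: "complex^'n"
    let ?y = "\<chi> i. if i = j then 0 else x $ i" and ?z = "\<chi> i. if i = j then x $ j else 0"
    have "?y \<in> fixsp (mono_mat m id ?c)" by (simp add: F)
    moreover have "x = ?y + ?z" by (simp add: vec_eq_iff)
    ultimately show "\<exists>y z. y \<in> fixsp (mono_mat m id ?c) \<and> (\<forall>i. i \<notin> {j} \<longrightarrow> z $ i = 0) \<and> x = y + z"
      by (intro exI[of _ ?y] exI[of _ ?z]) simp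
  qed
  moreover have "wt_set ?c UNIV = t" by (simp add: wt_set_def)
  then have "mono_mat m id ?c \<in> Gmpn m p" using t(1) by (intro Gmpn_I) (auto simp: permutes_id)
  ultimately show ?thesis by (simp add: reflections_def)
qed

lemma reflection_transposition:
  fixes i j :: "'n::finite"
  assumes ij: "i \<noteq> j"
  shows "mono_mat m (Transposition.transpose i j) (\<lambda>l. if l = i then t else if l = j then - t else 0)
           \<in> reflections m p"
proof -
  let ?c = "\<lambda>l. if l = i then t else if l = j then - t else 0"
  let ?g = "mono_mat m (Transposition.transpose i j) ?c"
  have F: "x \<in> fixsp ?g \<longleftrightarrow> x $ j = unit_root m t * x $ i" for x
    unfolding fixsp_mono_mat_iff[OF bij_transpose]
  proof (intro iffI allI)
    assume "\<forall>k. x $ Transposition.transpose i j k = unit_root m (?c k) * x $ k"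
    then show "x $ j = unit_root m t * x $ i" by (metis transpose_apply_first)
  next
    fix k assume xj: "x $ j = unit_root m t * x $ i"
    have "unit_root m (- t) * x $ j = x $ i"
      by (simp only: xj mult.assoc[symmetric] unit_root_add) simp
    then show "x $ Transposition.transpose i j k = unit_root m (?c k) * x $ k"
      using xj ij by (cases "k = i"; cases "k = j") auto
  qed
  have "codimfix ?g = card {j}"
  proof (rule codimfix_eq_card)
    fix x assume "x \<in> fixsp ?g" "\<forall>l. l \<notin> {j} \<longrightarrow> x $ l = 0"
    then show "\<forall>l\<in>{j}. x $ l = 0" using F ij by simp
  next
    fix x :: "complex^'n"
    let ?y = "\<chi> l. if l = j then unit_root m t * x $ i else x $ l"
      and ?z = "\<chi> l. if l = j then x $ j - unit_root m t * x $ i else 0"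
    have "?y \<in> fixsp ?g" using ij by (simp add: F)
    moreover have "x = ?y + ?z" by (simp add: vec_eq_iff)
    ultimately show "\<exists>y z. y \<in> fixsp ?g \<and> (\<forall>l. l \<notin> {j} \<longrightarrow> z $ l = 0) \<and> x = y + z"
      by (intro exI[of _ ?y] exI[of _ ?z]) simp
  qed
  moreover have "wt_set ?c UNIV = 0"
  proof -
    have "?c = (\<lambda>l. (if l = i then t else 0) + (if l = j then - t else 0))" using ij by auto
    then show ?thesis by (simp add: wt_set_def sum.distrib)
  qed
  then have "?g \<in> Gmpn m p" by (intro Gmpn_I) (auto simp: permutes_swap_id)
  ultimately show ?thesis by (simp add: reflections_def)
qed

section \<open>Factorisations into reflections\<close>

definition is_reflection_product :: "nat \<Rightarrow> nat \<Rightarrow> complex^'n::finite^'n \<Rightarrow> bool" where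
  "is_reflection_product m p g \<longleftrightarrow> (\<exists>rs. set rs \<subseteq> reflections m p \<and> foldr (**) rs (mat 1) = g)"

lemma is_reflection_product_mat_1: "is_reflection_product m p (mat 1)"
  unfolding is_reflection_product_def by (rule exI[of _ "[]"]) simp

lemma is_reflection_product_mult:
  assumes "r \<in> reflections m p" "is_reflection_product m p g"
  shows "is_reflection_product m p (r ** g)"
proof -
  obtain rs where "set rs \<subseteq> reflections m p" "foldr (**) rs (mat 1) = g"
    using assms(2) unfolding is_reflection_product_def by blast
  then show ?thesis unfolding is_reflection_product_def using assms(1) by (intro exI[of _ "r # rs"]) simp
qed

lemma reflection_transposition_unweighted:
  fixes i j :: "'n::finite"
  assumes "i \<noteq> j"
  shows "mono_mat m (Transposition.transpose i j) (\<lambda>_. 0) \<in> reflections m p"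
proof -
  have "(\<lambda>l::'n. if l = i then (0::int) else if l = j then - 0 else 0) = (\<lambda>_. 0)" by auto
  then show ?thesis using reflection_transposition[OF assms, of m 0 p] by simp
qed

lemma diagonal_single_is_reflection_product:
  fixes a :: "'n::finite \<Rightarrow> int"
  assumes m: "0 < m" and a: "\<forall>l. l \<noteq> k \<longrightarrow> a l = 0" and wt: "[wt_set a UNIV = 0] (mod int p)"
  shows "is_reflection_product m p (mono_mat m id a)"
proof -
  have a_eq: "a = (\<lambda>l. if l = k then a k else 0)" using a by auto
  have "wt_set a UNIV = (\<Sum>l\<in>UNIV. if l = k then a k else 0)"
    unfolding wt_set_def by (rule sum.cong) (use a in auto)
  then have ak: "[a k = 0] (mod int p)" using wt by simp
  show ?thesis
  proof (cases "[a k = 0] (mod int m)")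
    case True
    have "mono_mat m id a = mono_mat m id (\<lambda>_. 0)"
      by (rule mono_mat_cong[OF m]) (use True a in auto)
    then show ?thesis using is_reflection_product_mat_1 mono_mat_id by metis
  next
    case False
    then have "mono_mat m id a \<in> reflections m p"
      using reflection_diagonal[OF m ak False, of k] a_eq by simp
    then have "is_reflection_product m p (mono_mat m id a ** mat 1)"
      by (rule is_reflection_product_mult[OF _ is_reflection_product_mat_1])
    then show ?thesis by (simp only: matrix_mul_rid)
  qed
qed

lemma diagonal_is_reflection_product:
  fixes a :: "'n::finite \<Rightarrow> int"
  assumes m: "0 < m" and "finite F" and "\<forall>l. l \<notin> insert k F \<longrightarrow> a l = 0"
    and "[wt_set a UNIV = 0] (mod int p)"
  shows "is_reflection_product m p (mono_mat m id a)"
  using assms(2-4)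
proof (induction F arbitrary: a rule: finite_induct)
  case empty
  then show ?case by (intro diagonal_single_is_reflection_product[OF m]) auto
next
  case (insert j F)
  show ?case
  proof (cases "j = k")
    case True
    then show ?thesis using insert.IH insert.prems by simp
  next
    case False
    \<comment> \<open>two transpositions of (j k) move the weight at j over to k\<close>
    define a' where "a' = (\<lambda>l. if l = j then 0 else if l = k then a k + a j else a l)"
    define b where "b = (\<lambda>l. if l = j then - a j else if l = k then - (- a j) else 0)"
    have "a' = (\<lambda>l. a l + ((if l = k then a j else 0) - (if l = j then a j else 0)))"
      using False by (auto simp: a'_def)
    then have "wt_set a' UNIV = wt_set a UNIV" by (simp add: wt_set_def sum.distrib sum_subtractf)
    then have "[wt_set a' UNIV = 0] (mod int p)" using insert.prems(2) by simp
    moreover have "\<forall>l. l \<notin> insert k F \<longrightarrow> a' l = 0" using insert.prems(1) by (auto simp: a'_def)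
    ultimately have "is_reflection_product m p (mono_mat m id a')" by (intro insert.IH)
    moreover have "mono_mat m (Transposition.transpose j k) (\<lambda>_. 0) \<in> reflections m p"
      by (rule reflection_transposition_unweighted[OF False])
    ultimately have "is_reflection_product m p (mono_mat m (Transposition.transpose j k) b **
        (mono_mat m (Transposition.transpose j k) (\<lambda>_. 0) ** mono_mat m id a'))"
      unfolding b_def by (intro is_reflection_product_mult reflection_transposition[OF False])
    moreover have "mono_mat m (Transposition.transpose j k) b **
        (mono_mat m (Transposition.transpose j k) (\<lambda>_. 0) ** mono_mat m id a') = mono_mat m id a"
    proof -
      have "(\<lambda>l. b (Transposition.transpose j k l) + a' l) = a"
        using False by (auto simp: a'_def b_def transpose_def)
      then show ?thesis by (simp add: mono_mat_mult)
    qed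
    ultimately show ?thesis by metis
  qed
qed

lemma mono_mat_is_reflection_product:
  fixes u :: "'n::finite \<Rightarrow> 'n"
  assumes m: "0 < m" and u: "u permutes UNIV" and a: "[wt_set a UNIV = 0] (mod int p)"
  shows "is_reflection_product m p (mono_mat m u a)"
  using u finite[of "UNIV :: 'n set"]
proof (induction rule: permutes_induct)
  case id
  have "\<forall>l. l \<notin> insert undefined (UNIV :: 'n set) \<longrightarrow> a l = 0" by simp
  then show ?case by (rule diagonal_is_reflection_product[OF m finite _ a])
next
  case (swap x y v)
  have "mono_mat m (Transposition.transpose x y) (\<lambda>_. 0) \<in> reflections m p"
    by (rule reflection_transposition_unweighted[OF swap.hyps(3)])
  moreover have "mono_mat m (Transposition.transpose x y) (\<lambda>_. 0) ** mono_mat m v a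
      = mono_mat m (Transposition.transpose x y \<circ> v) a"
    by (simp add: mono_mat_mult)
  ultimately show ?case using is_reflection_product_mult[OF _ swap.IH] by metis
qed

lemma Gmpn_is_reflection_product:
  assumes "0 < m" "g \<in> Gmpn m p"
  shows "is_reflection_product m p g"
proof -
  obtain u a where "g = mono_mat m u a" "u permutes UNIV" "[wt_set a UNIV = 0] (mod int p)"
    using assms(2) unfolding Gmpn_def by blast
  then show ?thesis using mono_mat_is_reflection_product[OF assms(1)] by simp
qed

lemma lenR_obtain:
  assumes "is_reflection_product m p g"
  obtains rs where "length rs = lenR m p g" "set rs \<subseteq> reflections m p" "foldr (**) rs (mat 1) = g"
proof -
  have "\<exists>k rs. length rs = k \<and> set rs \<subseteq> reflections m p \<and> foldr (**) rs (mat 1) = g"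
    using assms unfolding is_reflection_product_def by blast
  from LeastI_ex[OF this] show ?thesis using that unfolding lenR_def by blast
qed

lemma codimfix_le_length:
  fixes rs :: "(complex^'n::finite^'n) list"
  assumes "set rs \<subseteq> reflections m p"
  shows "codimfix (foldr (**) rs (mat 1)) \<le> length rs"
  using assms
proof (induction rs)
  case Nil then show ?case by (simp add: codimfix_mat_1)
next
  case (Cons r rs)
  have "codimfix (r ** foldr (**) rs (mat 1)) \<le> codimfix r + codimfix (foldr (**) rs (mat 1))"
    by (rule codimfix_mult_le)
  then show ?case using Cons by (simp add: reflections_def)
qed

lemma codimfix_le_lenR:
  assumes "is_reflection_product m p g"
  shows "codimfix g \<le> lenR m p g"
proof -
  obtain rs where "length rs = lenR m p g" "set rs \<subseteq> reflections m p" "foldr (**) rs (mat 1) = g"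
    using lenR_obtain[OF assms] by blast
  then show ?thesis using codimfix_le_length by metis
qed

section \<open>Cycles of a permutation\<close>

lemma permutation_if_permutes_UNIV: "(g::'n::finite \<Rightarrow> 'n) permutes UNIV \<Longrightarrow> permutation g"
  using permutation_permutes finite by metis

lemma cycles_of_eq_range_orbit:
  assumes "(g::'n::finite \<Rightarrow> 'n) permutes UNIV"
  shows "cycles_of g = range (orbit g)"
  using orbit_altdef_permutation[OF permutation_if_permutes_UNIV[OF assms]]
  unfolding cycles_of_def by blast

lemma orbit_eq_if_mem:
  assumes "permutation g" "y \<in> orbit g x" shows "orbit g y = orbit g x"
  using orbit_cyclic_eq3[OF cyclic_on_orbit'[OF assms(1)] assms(2)] .

lemma mem_orbit_sym:
  assumes "permutation g" "y \<in> orbit g x" shows "x \<in> orbit g y"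
  using orbit_eq_if_mem[OF assms] permutation_self_in_orbit[OF assms(1)] by auto

lemma orbit_subset_if_image_subset:
  assumes "g ` B \<subseteq> B" "x \<in> B" shows "orbit g x \<subseteq> B"
proof
  fix y assume "y \<in> orbit g x" then show "y \<in> B"
    by induct (use assms in auto)
qed

lemma card_cycles_of_id: "card (cycles_of (id::'n::finite \<Rightarrow> 'n)) = CARD('n)"
proof -
  have "cycles_of (id::'n \<Rightarrow> 'n) = (\<lambda>i. {i}) ` UNIV" unfolding cycles_of_def by auto
  then show ?thesis by (simp add: card_image)
qed

context
  fixes g h :: "'n::finite \<Rightarrow> 'n" and i j :: 'n
  assumes g: "g permutes UNIV" and h: "h = g \<circ> Transposition.transpose i j"
begin

private lemma h_permutes: "h permutes UNIV"
  using g by (simp add: h permutes_compose permutes_swap_id)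

private lemma permutation_g: "permutation g"
  using g by (rule permutation_if_permutes_UNIV)

private lemma permutation_h: "permutation h"
  using h_permutes by (rule permutation_if_permutes_UNIV)

private lemma orbit_g_subset_orbits_h:
  assumes "y \<in> orbit g x" "x = i \<or> x = j" shows "y \<in> orbit h i \<union> orbit h j"
  using assms(1)
proof induct
  case base
  have "h j = g i" "h i = g j" by (simp_all add: h)
  then show ?case using assms(2) orbit.base[of h i] orbit.base[of h j] by auto
next
  case (step y)
  show ?case
  proof (cases "y = i \<or> y = j")
    case True
    have "h j = g i" "h i = g j" by (simp_all add: h)
    then show ?thesis using True orbit.base[of h i] orbit.base[of h j] by auto
  next
    case False
    then have "g y = h y" by (simp add: h)
    then show ?thesis using step(2) orbit.step[of y h i] orbit.step[of y h j] by auto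
  qed
qed

private lemma orbit_h_eq_orbit_g:
  assumes "y \<notin> orbit g i \<union> orbit g j" shows "orbit h y = orbit g y"
proof (rule orbit_cong[OF permutation_self_in_orbit[OF permutation_g]])
  fix s assume "s \<in> orbit g y"
  then have "y \<in> orbit g s" by (rule mem_orbit_sym[OF permutation_g])
  then have "s \<noteq> i" "s \<noteq> j" using assms by auto
  then show "h s = g s" by (simp add: h)
qed

private lemma mem_orbit_h_if_not_mem_orbit_g:
  assumes "j \<notin> orbit g i" shows "j \<in> orbit h i"
proof -
  have "y \<in> orbit h i" if "y \<in> orbit g j" for y
    using that
  proof induct
    case base
    have "h i = g j" by (simp add: h)
    then show ?case using orbit.base[of h i] by simp
  next
    case (step y)
    have "j \<in> orbit g y" by (rule mem_orbit_sym[OF permutation_g step(1)])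
    then have "y \<noteq> i" using assms by auto
    show ?case
    proof (cases "y = j")
      case True
      have "h i = g j" by (simp add: h)
      then show ?thesis using True orbit.base[of h i] by simp
    next
      case False
      then have "g y = h y" using \<open>y \<noteq> i\<close> by (simp add: h)
      then show ?thesis using step(2) orbit.step[of y h i] by simp
    qed
  qed
  then show ?thesis using permutation_self_in_orbit[OF permutation_g, of j] by blast
qed

private definition other_cycles :: "'n set set" where
  "other_cycles = {orbit g y | y. y \<notin> orbit g i \<union> orbit g j}"

private lemma cycles_of_g_eq: "cycles_of g = insert (orbit g i) (insert (orbit g j) other_cycles)"
proof -
  have "orbit g y \<in> insert (orbit g i) (insert (orbit g j) other_cycles)" for y
  proof (cases "y \<in> orbit g i \<union> orbit g j")
    case True
    then show ?thesis using orbit_eq_if_mem[OF permutation_g] by auto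
  qed (auto simp: other_cycles_def)
  moreover have "other_cycles \<subseteq> range (orbit g)" by (auto simp: other_cycles_def)
  ultimately show ?thesis unfolding cycles_of_eq_range_orbit[OF g] by auto
qed

private lemma cycles_of_h_subset: "cycles_of h \<subseteq> insert (orbit h i) (insert (orbit h j) other_cycles)"
proof
  fix C assume "C \<in> cycles_of h"
  then obtain y where C: "C = orbit h y" using cycles_of_eq_range_orbit[OF h_permutes] by auto
  show "C \<in> insert (orbit h i) (insert (orbit h j) other_cycles)"
  proof (cases "y \<in> orbit g i \<union> orbit g j")
    case True
    then have "y \<in> orbit h i \<union> orbit h j" using orbit_g_subset_orbits_h by blast
    then show ?thesis using orbit_eq_if_mem[OF permutation_h] C by auto
  next
    case False
    then show ?thesis using orbit_h_eq_orbit_g[OF False] C unfolding other_cycles_def by blast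
  qed
qed

private lemma orbits_g_notin_other_cycles: "orbit g i \<notin> other_cycles" "orbit g j \<notin> other_cycles"
  unfolding other_cycles_def using permutation_self_in_orbit[OF permutation_g] by blast+

lemma card_cycles_comp_transpose_le: "card (cycles_of h) \<le> card (cycles_of g) + 1"
proof -
  have "card (cycles_of h) \<le> card (insert (orbit h i) (insert (orbit h j) other_cycles))"
    by (rule card_mono[OF _ cycles_of_h_subset]) simp
  also have "\<dots> \<le> card other_cycles + 2" by (simp add: card_insert_le_m1)
  finally have "card (cycles_of h) \<le> card other_cycles + 2" .
  moreover have "card other_cycles + 1 = card (insert (orbit g i) other_cycles)"
    using orbits_g_notin_other_cycles by simp
  moreover have "\<dots> \<le> card (cycles_of g)" by (rule card_mono) (auto simp: cycles_of_g_eq)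
  ultimately show ?thesis by linarith
qed

lemma card_cycles_comp_transpose_merge:
  assumes "j \<notin> orbit g i"
  shows "card (cycles_of h) + 1 \<le> card (cycles_of g)"
proof -
  have "orbit h j = orbit h i"
    by (rule orbit_eq_if_mem[OF permutation_h mem_orbit_h_if_not_mem_orbit_g[OF assms]])
  then have "card (cycles_of h) \<le> card (insert (orbit h i) other_cycles)"
    using cycles_of_h_subset by (intro card_mono) auto
  also have "\<dots> \<le> card other_cycles + 1" by (simp add: card_insert_if)
  finally have "card (cycles_of h) \<le> card other_cycles + 1" .
  moreover have "orbit g i \<noteq> orbit g j"
    using assms permutation_self_in_orbit[OF permutation_g, of j] by blast
  then have "card other_cycles + 2 = card (cycles_of g)"
    using orbits_g_notin_other_cycles by (simp add: cycles_of_g_eq)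
  ultimately show ?thesis by linarith
qed

end

lemma card_cycles_transpose_comp:
  fixes v :: "'n::finite \<Rightarrow> 'n"
  assumes v: "v permutes UNIV"
  shows "card (cycles_of (Transposition.transpose i j \<circ> v)) \<le> card (cycles_of v) + 1"
    and "j \<notin> orbit v i \<Longrightarrow> card (cycles_of (Transposition.transpose i j \<circ> v)) + 1 \<le> card (cycles_of v)"
proof -
  have bv: "bij v" using v by (rule permutes_bij)
  let ?i = "inv v i" and ?j = "inv v j"
  have eq: "Transposition.transpose i j \<circ> v = v \<circ> Transposition.transpose ?i ?j"
    by (rule transpose_comp_eq[OF bv])
  show "card (cycles_of (Transposition.transpose i j \<circ> v)) \<le> card (cycles_of v) + 1"
    unfolding eq by (rule card_cycles_comp_transpose_le[OF v refl])
  assume j: "j \<notin> orbit v i"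
  have vi: "v ?i = i" "v ?j = j" using bv by (simp_all add: bij_is_surj surj_f_inv_f)
  have "orbit v ?i = orbit v i"
    using orbit_eq_if_mem[OF permutation_if_permutes_UNIV[OF v] orbit.base[of v ?i]] vi by simp
  moreover have "?j \<notin> orbit v i" using j vi orbit.step[of ?j v i] by auto
  ultimately have "?j \<notin> orbit v ?i" by simp
  then show "card (cycles_of (Transposition.transpose i j \<circ> v)) + 1 \<le> card (cycles_of v)"
    unfolding eq by (rule card_cycles_comp_transpose_merge[OF v refl])
qed

section \<open>A lower bound for the reflection length\<close>

lemma partition_on_block_unique:
  assumes "partition_on A P" "B \<in> P" "B' \<in> P" "x \<in> B" "x \<in> B'"
  shows "B = B'"
proof (rule ccontr)
  assume "B \<noteq> B'"
  then have "B \<inter> B' = {}" using assms(1-3) by (auto simp: partition_on_def disjoint_def)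
  then show False using assms(4,5) by blast
qed

lemma partition_on_UNIV_block:
  assumes "partition_on UNIV P"
  obtains B where "B \<in> P" "x \<in> B"
  using assms unfolding partition_on_def by blast

lemma partition_on_merge:
  assumes "partition_on A P" "X \<in> P" "Y \<in> P"
  shows "partition_on A (insert (X \<union> Y) (P - {X, Y}))"
proof (rule partition_onI)
  show "\<Union>(insert (X \<union> Y) (P - {X, Y})) = A"
    using assms partition_onD1[OF assms(1)] by auto
  show "{} \<notin> insert (X \<union> Y) (P - {X, Y})"
    using assms partition_onD3[OF assms(1)] by auto
  have dP: "disjnt Z W" if "Z \<in> P" "W \<in> P" "Z \<noteq> W" for Z W
    by (rule pairwiseD[OF partition_onD2[OF assms(1)] that])
  have dU: "disjnt (X \<union> Y) W" if "W \<in> P - {X, Y}" for W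
    using dP[OF assms(2), of W] dP[OF assms(3), of W] that by (auto simp: disjnt_Un1)
  fix Z W assume Z: "Z \<in> insert (X \<union> Y) (P - {X, Y})" and W: "W \<in> insert (X \<union> Y) (P - {X, Y})"
    and "Z \<noteq> W"
  show "disjnt Z W"
  proof (cases "Z = X \<union> Y")
    case True
    then show ?thesis using dU W \<open>Z \<noteq> W\<close> by simp
  next
    case False
    then have "Z \<in> P - {X, Y}" using Z by simp
    then show ?thesis
      using dP dU[of Z] W \<open>Z \<noteq> W\<close> by (cases "W = X \<union> Y") (auto simp: disjnt_sym)
  qed
qed

lemma sum_card_Diff_partition:
  assumes "partition_on (UNIV :: 'a::finite set) P"
  shows "(\<Sum>B\<in>P. card (B - X)) = card (- X)"
proof -
  have "- X = \<Union>((\<lambda>B. B - X) ` P)" using assms by (auto simp: partition_on_def)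
  moreover have "card (\<Union>((\<lambda>B. B - X) ` P)) = (\<Sum>B\<in>P. card (B - X))"
    by (rule card_UN_disjoint) (use assms in \<open>auto simp: partition_on_def disjoint_def\<close>)
  ultimately show ?thesis by simp
qed

lemma wt_set_Un: "A \<inter> B = {} \<Longrightarrow> wt_set b (A \<union> B) = wt_set b A + wt_set b (B::'n::finite set)"
  by (simp add: wt_set_def sum.union_disjoint)

lemma dvd_wt_set: "(\<And>l. l \<in> B \<Longrightarrow> (d::int) dvd c l) \<Longrightarrow> d dvd wt_set c B"
  unfolding wt_set_def by (rule dvd_sum) simp

lemma wt_set_shift:
  assumes "(v::'n::finite \<Rightarrow> 'n) permutes UNIV" "v ` B \<subseteq> B"
  shows "wt_set (\<lambda>l. c (v l) + b l) B = wt_set c B + wt_set b B"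
proof -
  have inj: "inj_on v B" by (rule inj_on_subset[OF permutes_inj[OF assms(1)]]) simp
  have "(\<Sum>l\<in>B. c l) = (\<Sum>l\<in>v ` B. c l)" by (simp only: endo_inj_surj[OF finite assms(2) inj])
  also have "\<dots> = (\<Sum>l\<in>B. c (v l))" by (simp add: sum.reindex[OF inj])
  finally show ?thesis by (simp add: wt_set_def sum.distrib)
qed

definition stable_partition :: "nat \<Rightarrow> ('n \<Rightarrow> 'n) \<Rightarrow> ('n \<Rightarrow> int) \<Rightarrow> 'n set set \<Rightarrow> bool" where
  "stable_partition p v b P \<longleftrightarrow> partition_on UNIV P \<and> (\<forall>B\<in>P. v ` B \<subseteq> B \<and> int p dvd wt_set b B)"

definition block_value :: "nat \<Rightarrow> ('n \<Rightarrow> int) \<Rightarrow> 'n set \<Rightarrow> nat" where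
  "block_value m b B = (if int m dvd wt_set b B then 2 else 1)"

definition partition_value :: "nat \<Rightarrow> ('n \<Rightarrow> int) \<Rightarrow> 'n set set \<Rightarrow> nat" where
  "partition_value m b P = (\<Sum>B\<in>P. block_value m b B)"

lemma stable_partition_diagonal_step:
  fixes v :: "'n::finite \<Rightarrow> 'n"
  assumes pm: "p dvd m" and v: "v permutes UNIV" and P: "stable_partition p v b P"
    and c: "\<forall>l. l \<noteq> j \<longrightarrow> int m dvd c l" "int p dvd wt_set c UNIV"
  shows "stable_partition p v (\<lambda>l. c (v l) + b l) P"
    and "partition_value m b P \<le> partition_value m (\<lambda>l. c (v l) + b l) P + 1"
proof -
  let ?b = "\<lambda>l. c (v l) + b l"
  have pm': "int p dvd int m" using pm by simp
  have cp: "int p dvd c l" for l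
  proof (cases "l = j")
    case True
    have "wt_set c UNIV = c j + wt_set c (UNIV - {j})"
      unfolding wt_set_def by (rule sum.remove[OF finite UNIV_I])
    moreover have "int p dvd wt_set c (UNIV - {j})"
      by (rule dvd_wt_set) (use c(1) pm' dvd_trans in blast)
    ultimately show ?thesis using c(2) True by (metis dvd_add_left_iff)
  next
    case False then show ?thesis using c(1) pm' dvd_trans by blast
  qed
  have wt_b: "wt_set ?b B = wt_set c B + wt_set b B" if "B \<in> P" for B
    using wt_set_shift[OF v] P that by (simp add: stable_partition_def)
  show "stable_partition p v ?b P"
    using P wt_b dvd_wt_set[of _ "int p" c, OF cp] by (simp add: stable_partition_def)
  have part: "partition_on UNIV P" using P by (simp add: stable_partition_def)
  obtain B0 where B0: "B0 \<in> P" "j \<in> B0" by (rule partition_on_UNIV_block[OF part])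
  have "block_value m b B \<le> block_value m ?b B + (if B = B0 then 1 else 0)" if B: "B \<in> P" for B
  proof (cases "B = B0")
    case False
    then have "j \<notin> B" using partition_on_block_unique[OF part B B0(1) _ B0(2)] by blast
    then have "int m dvd wt_set c B" using c(1) by (intro dvd_wt_set) auto
    then show ?thesis using wt_b[OF B] by (simp add: block_value_def dvd_add_right_iff)
  qed (simp add: block_value_def)
  then have "partition_value m b P \<le> (\<Sum>B\<in>P. block_value m ?b B + (if B = B0 then 1 else 0))"
    unfolding partition_value_def by (rule sum_mono)
  also have "\<dots> = partition_value m ?b P + 1" using B0(1) by (simp add: partition_value_def sum.distrib)
  finally show "partition_value m b P \<le> partition_value m ?b P + 1" .
qed

lemma dvd_wt_set_transposition_weights:
  fixes c :: "'n::finite \<Rightarrow> int"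
  assumes ij: "i \<noteq> j" and c: "\<forall>l. l \<noteq> i \<longrightarrow> l \<noteq> j \<longrightarrow> int m dvd c l" "int m dvd c i + c j"
    and B: "i \<in> B \<longleftrightarrow> j \<in> B"
  shows "int m dvd wt_set c B"
proof (cases "i \<in> B")
  case True
  then have "j \<in> B - {i}" using B ij by simp
  have "wt_set c B = c i + wt_set c (B - {i})"
    unfolding wt_set_def by (rule sum.remove[OF finite True])
  also have "wt_set c (B - {i}) = c j + wt_set c (B - {i} - {j})"
    unfolding wt_set_def by (rule sum.remove[OF finite \<open>j \<in> B - {i}\<close>])
  finally have "wt_set c B = (c i + c j) + wt_set c (B - {i} - {j})" by simp
  moreover have "int m dvd wt_set c (B - {i} - {j})" by (rule dvd_wt_set) (use c(1) in auto)
  ultimately show ?thesis using c(2) by simp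
next
  case False
  then show ?thesis using B c(1) by (intro dvd_wt_set) auto
qed

lemma transpose_comp_image_subset:
  assumes "v ` B \<subseteq> B" "i \<in> B \<longleftrightarrow> j \<in> B"
  shows "(Transposition.transpose i j \<circ> v) ` B \<subseteq> B"
proof (rule image_subsetI)
  fix y assume "y \<in> B"
  then have vy: "v y \<in> B" by (rule subsetD[OF assms(1) imageI])
  consider "v y = i" | "v y = j" | "v y \<noteq> i" "v y \<noteq> j" by blast
  then show "(Transposition.transpose i j \<circ> v) y \<in> B"
  proof cases
    case 1 then show ?thesis using vy assms(2) by simp
  next
    case 2 then show ?thesis using vy assms(2) by simp
  next
    case 3 then show ?thesis using vy by simp
  qed
qed

lemma stable_partition_transposition_step_within:
  fixes v :: "'n::finite \<Rightarrow> 'n"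
  assumes pm: "p dvd m" and v: "v permutes UNIV" and P: "stable_partition p v b P"
    and c: "\<forall>l. l \<noteq> i \<longrightarrow> l \<noteq> j \<longrightarrow> int m dvd c l" "int m dvd c i + c j" and ij: "i \<noteq> j"
    and same_block: "\<And>B. B \<in> P \<Longrightarrow> i \<in> B \<longleftrightarrow> j \<in> B"
  shows "stable_partition p (Transposition.transpose i j \<circ> v) (\<lambda>l. c (v l) + b l) P"
    and "partition_value m (\<lambda>l. c (v l) + b l) P = partition_value m b P"
proof -
  let ?b = "\<lambda>l. c (v l) + b l"
  have cm: "int m dvd wt_set c B" if "B \<in> P" for B
    by (rule dvd_wt_set_transposition_weights[OF ij c same_block[OF that]])
  have wt_b: "wt_set ?b B = wt_set c B + wt_set b B" if "B \<in> P" for B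
    using wt_set_shift[OF v] P that by (simp add: stable_partition_def)
  show "stable_partition p (Transposition.transpose i j \<circ> v) ?b P"
    unfolding stable_partition_def
  proof (intro conjI ballI)
    show "partition_on UNIV P" using P by (simp add: stable_partition_def)
  next
    fix B assume B: "B \<in> P"
    have "v ` B \<subseteq> B" using P B by (simp add: stable_partition_def)
    then show "(Transposition.transpose i j \<circ> v) ` B \<subseteq> B"
      by (rule transpose_comp_image_subset[OF _ same_block[OF B]])
    show "int p dvd wt_set ?b B"
      using wt_b[OF B] P B dvd_trans[OF _ cm[OF B], of "int p"] pm by (simp add: stable_partition_def)
  qed
  show "partition_value m ?b P = partition_value m b P"
    unfolding partition_value_def block_value_def
    by (rule sum.cong) (use wt_b cm in \<open>auto simp: dvd_add_right_iff\<close>)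
qed

lemma partition_value_merge:
  fixes P :: "'n::finite set set"
  assumes "X \<in> P" "Y \<in> P" "X \<noteq> Y" "X \<union> Y \<notin> P - {X, Y}"
    and "\<And>B. B \<in> P - {X, Y} \<Longrightarrow> block_value m b' B = block_value m b B"
    and "block_value m b X + block_value m b Y \<le> block_value m b' (X \<union> Y) + 2"
  shows "partition_value m b P \<le> partition_value m b' (insert (X \<union> Y) (P - {X, Y})) + 2"
proof -
  have "P = insert X (insert Y (P - {X, Y}))" "X \<notin> insert Y (P - {X, Y})" "Y \<notin> P - {X, Y}"
    using assms(1-3) by auto
  then have "partition_value m b P
      = block_value m b X + block_value m b Y + (\<Sum>B\<in>P - {X, Y}. block_value m b B)"
    unfolding partition_value_def by (metis finite sum.insert add.assoc)
  moreover have "partition_value m b' (insert (X \<union> Y) (P - {X, Y}))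
      = block_value m b' (X \<union> Y) + (\<Sum>B\<in>P - {X, Y}. block_value m b B)"
    unfolding partition_value_def using assms(4,5) by simp
  ultimately show ?thesis using assms(6) by linarith
qed

lemma stable_partition_transposition_step_merge:
  fixes v :: "'n::finite \<Rightarrow> 'n"
  assumes pm: "p dvd m" and v: "v permutes UNIV" and P: "stable_partition p v b P"
    and c: "\<forall>l. l \<noteq> i \<longrightarrow> l \<noteq> j \<longrightarrow> int m dvd c l" "int m dvd c i + c j" and ij: "i \<noteq> j"
    and blocks: "X \<in> P" "Y \<in> P" "i \<in> X" "j \<in> Y" "X \<noteq> Y"
  shows "stable_partition p (Transposition.transpose i j \<circ> v) (\<lambda>l. c (v l) + b l)
      (insert (X \<union> Y) (P - {X, Y}))"
    and "partition_value m b P \<le> partition_value m (\<lambda>l. c (v l) + b l) (insert (X \<union> Y) (P - {X, Y})) + 2"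
proof -
  let ?b = "\<lambda>l. c (v l) + b l" and ?Q = "P - {X, Y}"
  have part: "partition_on UNIV P" and stab: "\<And>B. B \<in> P \<Longrightarrow> v ` B \<subseteq> B"
    and wt_p: "\<And>B. B \<in> P \<Longrightarrow> int p dvd wt_set b B"
    using P by (auto simp: stable_partition_def)
  have pm': "int p dvd int m" using pm by simp
  have XY: "X \<inter> Y = {}"
    using pairwiseD[OF partition_onD2[OF part] blocks(1,2,5)] by (simp add: disjnt_def)
  have outside: "i \<notin> B" "j \<notin> B" if "B \<in> ?Q" for B
    using that blocks partition_on_block_unique[OF part] by blast+
  have cm: "int m dvd wt_set c B" if "B \<in> insert (X \<union> Y) ?Q" for B
    by (rule dvd_wt_set_transposition_weights[OF ij c]) (use that blocks outside in auto)
  have stab_U: "v ` (X \<union> Y) \<subseteq> X \<union> Y" using stab blocks(1,2) by blast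
  have wt_b: "wt_set ?b B = wt_set c B + wt_set b B" if "v ` B \<subseteq> B" for B
    by (rule wt_set_shift[OF v that])
  have wt_U: "wt_set b (X \<union> Y) = wt_set b X + wt_set b Y" by (rule wt_set_Un[OF XY])
  show "stable_partition p (Transposition.transpose i j \<circ> v) ?b (insert (X \<union> Y) ?Q)"
    unfolding stable_partition_def
  proof (intro conjI ballI)
    show "partition_on UNIV (insert (X \<union> Y) ?Q)" by (rule partition_on_merge[OF part blocks(1,2)])
  next
    fix B assume B: "B \<in> insert (X \<union> Y) ?Q"
    then have "v ` B \<subseteq> B" using stab stab_U by blast
    moreover have "i \<in> B \<longleftrightarrow> j \<in> B" using B blocks outside by auto
    ultimately show "(Transposition.transpose i j \<circ> v) ` B \<subseteq> B" by (rule transpose_comp_image_subset)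
    have "int p dvd wt_set b B" using B wt_p blocks(1,2) wt_U by auto
    then show "int p dvd wt_set ?b B"
      using wt_b[OF \<open>v ` B \<subseteq> B\<close>] dvd_trans[OF pm' cm[OF B]] by simp
  qed
  have value_Q: "block_value m ?b B = block_value m b B" if "B \<in> ?Q" for B
    using wt_b[OF stab] cm that by (simp add: block_value_def dvd_add_right_iff)
  have value_U: "block_value m b X + block_value m b Y \<le> block_value m ?b (X \<union> Y) + 2"
    using wt_b[OF stab_U] wt_U cm[of "X \<union> Y"] by (auto simp: block_value_def)
  have "X \<union> Y \<notin> ?Q" using blocks outside by blast
  then show "partition_value m b P \<le> partition_value m ?b (insert (X \<union> Y) ?Q) + 2"
    by (rule partition_value_merge[OF blocks(1,2,5) _ value_Q value_U])
qed

lemma stable_partition_reflection_step: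
  fixes v :: "'n::finite \<Rightarrow> 'n"
  assumes m: "0 < m" and pm: "p dvd m" and v: "v permutes UNIV" and P: "stable_partition p v b P"
    and s: "s permutes UNIV" and c: "int p dvd wt_set c UNIV" and codim: "codimfix (mono_mat m s c) = 1"
  shows "\<exists>Q. stable_partition p (s \<circ> v) (\<lambda>l. c (v l) + b l) Q \<and>
    card (cycles_of (s \<circ> v)) + partition_value m b P
      \<le> card (cycles_of v) + partition_value m (\<lambda>l. c (v l) + b l) Q + 1"
proof -
  have part: "partition_on UNIV P" using P by (simp add: stable_partition_def)
  consider "s = id" | i j where "i \<noteq> j" "s = Transposition.transpose i j"
    using reflection_perm_cases[OF permutes_bij[OF s] codim] by blast
  then show ?thesis
  proof cases
    case 1
    obtain j where "\<forall>l. l \<noteq> j \<longrightarrow> int m dvd c l"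
      using reflection_diagonal_weights[OF m] codim 1 by (auto simp: cong_0_iff)
    then show ?thesis using stable_partition_diagonal_step[OF pm v P _ c] 1 by (intro exI[of _ P]) auto
  next
    case (2 i j)
    have cm: "\<forall>l. l \<noteq> i \<longrightarrow> l \<noteq> j \<longrightarrow> int m dvd c l" "int m dvd c i + c j"
      using reflection_transposition_weights[OF m 2(1)] codim 2(2) by (simp_all add: cong_0_iff)
    obtain X Y where XY: "X \<in> P" "i \<in> X" "Y \<in> P" "j \<in> Y"
      using partition_on_UNIV_block[OF part] by metis
    show ?thesis
    proof (cases "X = Y")
      case True
      then have "i \<in> B \<longleftrightarrow> j \<in> B" if "B \<in> P" for B
        using XY that partition_on_block_unique[OF part] by blast
      then show ?thesis
        using stable_partition_transposition_step_within[OF pm v P cm 2(1)]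
          card_cycles_transpose_comp(1)[OF v, of i j] 2(2)
        by (intro exI[of _ P]) auto
    next
      case False
      \<comment> \<open>i and j lie in different v-stable blocks, hence in different cycles of v,
        which the transposition merges\<close>
      have j: "j \<notin> orbit v i"
        using orbit_subset_if_image_subset[of v X i] P XY False partition_on_block_unique[OF part]
        by (auto simp: stable_partition_def)
      show ?thesis
        using stable_partition_transposition_step_merge[OF pm v P cm 2(1) XY(1,3,2,4) False]
          card_cycles_transpose_comp(2)[OF v j] 2(2)
        by (intro exI[of _ "insert (X \<union> Y) (P - {X, Y})"]) auto
    qed
  qed
qed

lemma mono_mat_left_quotient:
  assumes "bij s" "mono_mat m s c ** g = mono_mat m v b"
  shows "g = mono_mat m (inv s \<circ> v) (\<lambda>l. b l - c ((inv s \<circ> v) l))"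
proof -
  have "g = (mono_mat m (inv s) (inv_weights s c) ** mono_mat m s c) ** g"
    using mono_mat_inv_left[OF assms(1)] by (simp add: matrix_mul_lid)
  also have "\<dots> = mono_mat m (inv s) (inv_weights s c) ** mono_mat m v b"
    by (simp only: matrix_mul_assoc[symmetric] assms(2))
  also have "\<dots> = mono_mat m (inv s \<circ> v) (\<lambda>l. b l - c ((inv s \<circ> v) l))"
    by (simp add: mono_mat_mult inv_weights_def)
  finally show ?thesis .
qed

text \<open>For the partition into the cycles of v the partition value is c(v) + c_0(v); then this is the
  classical bound l_R >= n - c_0(v) in G(m,1,n).\<close>

lemma reflection_length_lower_bound:
  fixes rs :: "(complex^'n::finite^'n) list"
  assumes m: "0 < m" and pm: "p dvd m"
  shows "set rs \<subseteq> reflections m p \<Longrightarrow> v permutes UNIV \<Longrightarrow> foldr (**) rs (mat 1) = mono_mat m v b \<Longrightarrow>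
     \<exists>P. stable_partition p v b P \<and> CARD('n) + card (cycles_of v) \<le> length rs + partition_value m b P"
proof (induction rs arbitrary: v b)
  case Nil
  then have e: "mono_mat m id (\<lambda>_. 0) = mono_mat m v b" by (simp add: mono_mat_id)
  have "v = id" using mono_mat_inj(1)[OF m e] by simp
  have bm: "int m dvd b k" for k using mono_mat_inj(2)[OF m e, of k] by (metis cong_0_iff cong_sym)
  then have bp: "int p dvd b k" for k using pm dvd_trans of_nat_dvd_iff by blast
  let ?P = "range (\<lambda>k::'n. {k})"
  have "stable_partition p v b ?P"
    using partition_on_singletons[of "UNIV :: 'n set"] \<open>v = id\<close> bp
    by (auto simp: stable_partition_def wt_set_def)
  moreover have "partition_value m b ?P = 2 * CARD('n)"
    unfolding partition_value_def using bm
    by (subst sum.reindex) (auto simp: inj_on_def block_value_def wt_set_def)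
  moreover have "card (cycles_of v) = CARD('n)" using \<open>v = id\<close> card_cycles_of_id by simp
  ultimately show ?case by (intro exI[of _ ?P]) simp
next
  case (Cons r rs)
  obtain s c where r: "r = mono_mat m s c" "s permutes UNIV" "[wt_set c UNIV = 0] (mod int p)"
    "codimfix r = 1"
    using Cons.prems(1) unfolding reflections_def Gmpn_def by auto
  define v' where "v' = inv s \<circ> v"
  define b' where "b' = (\<lambda>l. b l - c (v' l))"
  have v': "v' permutes UNIV"
    unfolding v'_def by (rule permutes_compose[OF Cons.prems(2) permutes_inv[OF r(2)]])
  have "foldr (**) rs (mat 1) = mono_mat m v' b'"
    unfolding v'_def b'_def
    by (rule mono_mat_left_quotient[OF permutes_bij[OF r(2)]]) (use Cons.prems r in simp)
  then obtain P' where P': "stable_partition p v' b' P'"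
      "CARD('n) + card (cycles_of v') \<le> length rs + partition_value m b' P'"
    using Cons.IH[OF _ v'] Cons.prems(1) by auto
  have "int p dvd wt_set c UNIV" using r(3) by (simp add: cong_0_iff)
  then obtain Q where Q: "stable_partition p (s \<circ> v') (\<lambda>l. c (v' l) + b' l) Q"
    "card (cycles_of (s \<circ> v')) + partition_value m b' P'
       \<le> card (cycles_of v') + partition_value m (\<lambda>l. c (v' l) + b' l) Q + 1"
    using stable_partition_reflection_step[OF m pm v' P'(1) r(2)] r(1,4) by blast
  have "s \<circ> v' = v" using permutes_surj[OF r(2)] by (simp add: v'_def o_assoc surj_iff)
  moreover have "(\<lambda>l. c (v' l) + b' l) = b" by (simp add: b'_def)
  ultimately show ?case using Q P'(2) by (intro exI[of _ Q]) simp
qed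

section \<open>Restricting an element to some of its cycles\<close>

lemma perm_restrict_permutes_UNIV:
  fixes f :: "'n::finite \<Rightarrow> 'n"
  assumes f: "f permutes UNIV" and S: "\<And>x. f x \<in> S \<longleftrightarrow> x \<in> S"
  shows "perm_restrict f S permutes UNIV"
proof -
  have "inj (perm_restrict f S)"
  proof (rule injI)
    fix x y assume "perm_restrict f S x = perm_restrict f S y"
    then show "x = y"
      using S permutes_inj[OF f] by (auto simp: perm_restrict_def inj_eq split: if_splits)
  qed
  then show ?thesis by (intro bij_imp_permutes) (simp_all add: bij_def finite_UNIV_inj_surj)
qed

lemma dvd_sum_nondvd_part:
  fixes f :: "'a \<Rightarrow> int"
  assumes "finite S" "d dvd e" "d dvd (\<Sum>C\<in>S. f C)"
  shows "d dvd (\<Sum>C\<in>{C \<in> S. \<not> e dvd f C}. f C)"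
proof -
  let ?T = "{C \<in> S. \<not> e dvd f C}"
  have split: "(\<Sum>C\<in>S. f C) = (\<Sum>C\<in>S - ?T. f C) + (\<Sum>C\<in>?T. f C)"
    by (rule sum.subset_diff) (use assms(1) in auto)
  have "d dvd (\<Sum>C\<in>S - ?T. f C)"
  proof (rule dvd_sum)
    fix C assume "C \<in> S - ?T"
    then have "e dvd f C" by blast
    then show "d dvd f C" by (rule dvd_trans[OF assms(2)])
  qed
  then show ?thesis using assms(3) unfolding split by (simp only: dvd_add_right_iff)
qed

locale cycle_restriction =
  fixes m :: nat and u :: "'n::finite \<Rightarrow> 'n" and a :: "'n \<Rightarrow> int" and T :: "'n set set"
  assumes m: "0 < m" and u: "u permutes UNIV" and T: "T \<subseteq> cycles_of u"
begin

definition covered :: "'n set" where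
  "covered = \<Union>T"

definition wt_in :: "'n \<Rightarrow> int" where
  "wt_in l = (if l \<in> covered then a l else 0)"

definition wt_out :: "'n \<Rightarrow> int" where
  "wt_out l = (if l \<in> covered then 0 else a l)"

abbreviation "w \<equiv> mono_mat m u a"
abbreviation "w_in \<equiv> mono_mat m (perm_restrict u covered) wt_in"
abbreviation "w_out \<equiv> mono_mat m (perm_restrict u (- covered)) wt_out"

lemma permutation_u: "permutation u"
  using u by (rule permutation_if_permutes_UNIV)

lemma cycle_eq_orbit: "C \<in> cycles_of u \<Longrightarrow> k \<in> C \<Longrightarrow> orbit u k = C"
  using orbit_eq_if_mem[OF permutation_u] cycles_of_eq_range_orbit[OF u] by auto

lemma cycle_nonempty: "C \<in> cycles_of u \<Longrightarrow> C \<noteq> {}"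
  using orbit_nonempty cycles_of_eq_range_orbit[OF u] by (metis imageE)

lemma cycles_disjoint: "C \<in> cycles_of u \<Longrightarrow> D \<in> cycles_of u \<Longrightarrow> C \<noteq> D \<Longrightarrow> C \<inter> D = {}"
  using cycle_eq_orbit by blast

lemma u_mem_covered_iff: "u k \<in> covered \<longleftrightarrow> k \<in> covered"
proof -
  have "orbit u (u k) = orbit u k" by (rule orbit_eq_if_mem[OF permutation_u orbit.base])
  then have "u k \<in> C \<longleftrightarrow> k \<in> C" if "C \<in> T" for C
    using that T cycle_eq_orbit permutation_self_in_orbit[OF permutation_u] by blast
  then show ?thesis by (auto simp: covered_def)
qed

lemma perm_restrict_covered_permutes: "perm_restrict u covered permutes UNIV"
  by (rule perm_restrict_permutes_UNIV[OF u u_mem_covered_iff])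

lemma perm_restrict_uncovered_permutes: "perm_restrict u (- covered) permutes UNIV"
  by (rule perm_restrict_permutes_UNIV[OF u]) (simp add: u_mem_covered_iff)

lemma w_in_mult_w_out: "w_in ** w_out = w"
proof -
  have "perm_restrict u covered \<circ> perm_restrict u (- covered) = u"
    by (auto simp: fun_eq_iff perm_restrict_def u_mem_covered_iff)
  moreover have "(\<lambda>l. wt_in (perm_restrict u (- covered) l) + wt_out l) = a"
    by (auto simp: fun_eq_iff perm_restrict_def wt_in_def wt_out_def u_mem_covered_iff)
  ultimately show ?thesis by (simp add: mono_mat_mult)
qed

lemma matrix_inv_w_in_mult: "matrix_inv w_in ** w = w_out"
proof -
  have b: "bij (perm_restrict u covered)" using perm_restrict_covered_permutes by (rule permutes_bij)
  have "matrix_inv w_in ** w = (matrix_inv w_in ** w_in) ** w_out"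
    by (simp only: w_in_mult_w_out[symmetric] matrix_mul_assoc)
  also have "\<dots> = w_out"
    by (simp only: matrix_inv_mono_mat[OF b] mono_mat_inv_left[OF b] matrix_mul_lid)
  finally show ?thesis .
qed

lemma fixsp_w_in_iff: "x \<in> fixsp w_in \<longleftrightarrow> (\<forall>k\<in>covered. x $ u k = unit_root m (a k) * x $ k)"
  unfolding fixsp_mono_mat_iff[OF permutes_bij[OF perm_restrict_covered_permutes]]
  by (auto simp: perm_restrict_def wt_in_def)

lemma fixsp_w_out_iff: "x \<in> fixsp w_out \<longleftrightarrow> (\<forall>k. k \<notin> covered \<longrightarrow> x $ u k = unit_root m (a k) * x $ k)"
  unfolding fixsp_mono_mat_iff[OF permutes_bij[OF perm_restrict_uncovered_permutes]]
  by (auto simp: perm_restrict_def wt_out_def)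

lemma codimfix_w_eq_add: "codimfix w = codimfix w_in + codimfix w_out"
proof (rule codimfix_eq_add)
  show "fixsp w = fixsp w_in \<inter> fixsp w_out"
    unfolding set_eq_iff Int_iff fixsp_mono_mat_iff[OF permutes_bij[OF u]] fixsp_w_in_iff fixsp_w_out_iff
    by blast
next
  fix x :: "complex^'n"
  let ?y = "\<chi> i. if i \<in> covered then 0 else x $ i" and ?z = "\<chi> i. if i \<in> covered then x $ i else 0"
  have "?y \<in> fixsp w_in" "?z \<in> fixsp w_out"
    unfolding fixsp_w_in_iff fixsp_w_out_iff by (simp_all add: u_mem_covered_iff)
  moreover have "x = ?y + ?z" by (simp add: vec_eq_iff)
  ultimately show "\<exists>y z. y \<in> fixsp w_in \<and> z \<in> fixsp w_out \<and> x = y + z" by blast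
qed

lemma codimfix_w_in_le: "codimfix w_in \<le> card covered"
proof (rule codimfix_le_card)
  fix x :: "complex^'n" assume "\<forall>i\<in>covered. x $ i = 0"
  then have "x \<in> fixsp w_in" unfolding fixsp_w_in_iff by (simp add: u_mem_covered_iff)
  then show "w_in *v x = x" by (simp add: fixsp_def)
qed

lemma orbit_perm_restrict_covered: "C \<in> T \<Longrightarrow> k \<in> C \<Longrightarrow> orbit (perm_restrict u covered) k = C"
proof -
  assume C: "C \<in> T" "k \<in> C"
  then have "k \<in> covered" by (auto simp: covered_def)
  moreover have "perm_restrict u covered \<in> covered \<rightarrow> covered"
    by (auto simp: perm_restrict_def u_mem_covered_iff)
  ultimately have "orbit (perm_restrict u covered) k = orbit u k"
    by (rule orbit_cong0) (simp add: perm_restrict_def)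
  then show ?thesis using cycle_eq_orbit C T by blast
qed

lemma orbit_perm_restrict_uncovered: "k \<notin> covered \<Longrightarrow> orbit (perm_restrict u covered) k = {k}"
  by (simp add: orbit_eq_singleton_iff perm_restrict_def)

lemma card_cycles_of_perm_restrict_covered:
  "card (cycles_of (perm_restrict u covered)) = card T + card (- covered)"
proof -
  have "cycles_of (perm_restrict u covered) = T \<union> (\<lambda>k. {k}) ` (- covered)"
  proof -
    have "orbit (perm_restrict u covered) k \<in> T \<union> (\<lambda>k. {k}) ` (- covered)" for k
      using orbit_perm_restrict_covered orbit_perm_restrict_uncovered
      by (cases "k \<in> covered") (auto simp: covered_def)
    moreover have "C \<in> range (orbit (perm_restrict u covered))" if "C \<in> T" for C
      using that cycle_nonempty T orbit_perm_restrict_covered by (metis all_not_in_conv rangeI subsetD)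
    moreover have "{k} \<in> range (orbit (perm_restrict u covered))" if "k \<notin> covered" for k
      using orbit_perm_restrict_uncovered[OF that] by (metis rangeI)
    ultimately show ?thesis unfolding cycles_of_eq_range_orbit[OF perm_restrict_covered_permutes] by blast
  qed
  moreover have "T \<inter> (\<lambda>k. {k}) ` (- covered) = {}" by (auto simp: covered_def)
  moreover have "card ((\<lambda>k. {k}) ` (- covered)) = card (- covered)" by (rule card_image) simp
  ultimately show ?thesis by (simp add: card_Un_disjoint)
qed

lemma wt_set_Union_cycles:
  assumes "T' \<subseteq> T"
  shows "wt_set a (\<Union>T') = (\<Sum>C\<in>T'. wt_set a C)"
  unfolding wt_set_def
proof (rule sum.Union_disjoint[simplified])
  show "\<forall>A\<in>T'. \<forall>B\<in>T'. A \<noteq> B \<longrightarrow> A \<inter> B = {}" using assms T cycles_disjoint by blast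
qed simp

lemma wt_set_wt_in: "wt_set wt_in B = wt_set a (B \<inter> covered)"
  unfolding wt_set_def wt_in_def by (simp add: sum.inter_restrict)

lemma w_in_Gmpn:
  assumes "int p dvd (\<Sum>C\<in>T. wt_set a C)"
  shows "w_in \<in> Gmpn m p"
proof (rule Gmpn_I[OF perm_restrict_covered_permutes])
  have "wt_set wt_in UNIV = (\<Sum>C\<in>T. wt_set a C)"
    by (simp add: wt_set_wt_in wt_set_Union_cycles covered_def)
  then show "[wt_set wt_in UNIV = 0] (mod int p)" using assms by (simp add: cong_0_iff)
qed

lemma wt_set_wt_out_UNIV: "wt_set wt_out UNIV = wt_set a UNIV - wt_set wt_in UNIV"
proof -
  have "wt_out = (\<lambda>l. a l - wt_in l)" by (auto simp: wt_in_def wt_out_def)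
  then show ?thesis by (simp add: wt_set_def sum_subtractf)
qed

lemma w_out_Gmpn:
  assumes "p dvd m" "w \<in> Gmpn m p" "w_in \<in> Gmpn m p"
  shows "w_out \<in> Gmpn m p"
proof (rule Gmpn_I[OF perm_restrict_uncovered_permutes])
  have "int p dvd wt_set a UNIV" by (rule Gmpn_wt_set_dvd[OF m assms(1,2)])
  moreover have "int p dvd wt_set wt_in UNIV" by (rule Gmpn_wt_set_dvd[OF m assms(1,3)])
  ultimately show "[wt_set wt_out UNIV = 0] (mod int p)"
    by (simp add: wt_set_wt_out_UNIV cong_0_iff)
qed

definition cycles_in :: "'n set \<Rightarrow> 'n set set" where
  "cycles_in B = {C \<in> T. C \<subseteq> B}"

lemma cycle_subset_block:
  assumes "perm_restrict u covered ` B \<subseteq> B" "C \<in> T" "k \<in> C" "k \<in> B"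
  shows "C \<subseteq> B"
  using orbit_subset_if_image_subset[OF assms(1,4)] orbit_perm_restrict_covered[OF assms(2,3)] by simp

lemma block_Int_covered:
  assumes "perm_restrict u covered ` B \<subseteq> B"
  shows "B \<inter> covered = \<Union>(cycles_in B)"
  using cycle_subset_block[OF assms] by (auto simp: covered_def cycles_in_def)

lemma wt_set_wt_in_block:
  assumes "perm_restrict u covered ` B \<subseteq> B"
  shows "wt_set wt_in B = (\<Sum>C\<in>cycles_in B. wt_set a C)"
  using wt_set_Union_cycles[of "cycles_in B"]
  by (simp add: wt_set_wt_in block_Int_covered[OF assms] cycles_in_def)

definition tight_block :: "'n set \<Rightarrow> bool" where
  "tight_block B \<longleftrightarrow> (cycles_in B = {} \<and> card (B - covered) = 1) \<or> card (cycles_in B) = 1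
     \<or> (card (cycles_in B) = 2 \<and> int m dvd wt_set wt_in B)"

context
  fixes p :: nat and P :: "'n set set"
  assumes P: "stable_partition p (perm_restrict u covered) wt_in P"
begin

private lemma partition_on_P: "partition_on UNIV P"
  using P by (simp add: stable_partition_def)

private lemma block_stable: "B \<in> P \<Longrightarrow> perm_restrict u covered ` B \<subseteq> B"
  using P by (simp add: stable_partition_def)

lemma cycles_in_cover:
  assumes "C \<in> T" obtains B where "B \<in> P" "C \<in> cycles_in B"
proof -
  obtain k where k: "k \<in> C" using cycle_nonempty assms T by blast
  obtain B where B: "B \<in> P" "k \<in> B" by (rule partition_on_UNIV_block[OF partition_on_P])
  then have "C \<subseteq> B" using cycle_subset_block[OF block_stable assms k] by blast
  then show ?thesis using that B(1) assms by (simp add: cycles_in_def)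
qed

lemma cycles_in_disjoint:
  assumes "B \<in> P" "B' \<in> P" "B \<noteq> B'"
  shows "cycles_in B \<inter> cycles_in B' = {}"
proof -
  have "B \<inter> B' = {}"
    using pairwiseD[OF partition_onD2[OF partition_on_P] assms] by (simp add: disjnt_def)
  then show ?thesis using cycle_nonempty T by (fastforce simp: cycles_in_def)
qed

lemma sum_card_cycles_in: "(\<Sum>B\<in>P. card (cycles_in B)) = card T"
proof -
  have "T = \<Union>(cycles_in ` P)"
  proof
    show "T \<subseteq> \<Union>(cycles_in ` P)"
    proof
      fix C assume "C \<in> T"
      then obtain B where "B \<in> P" "C \<in> cycles_in B" by (rule cycles_in_cover)
      then show "C \<in> \<Union>(cycles_in ` P)" by blast
    qed
    show "\<Union>(cycles_in ` P) \<subseteq> T" by (auto simp: cycles_in_def)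
  qed
  moreover have "card (\<Union>(cycles_in ` P)) = (\<Sum>B\<in>P. card (cycles_in B))"
    by (rule card_UN_disjoint) (use cycles_in_disjoint in auto)
  ultimately show ?thesis by simp
qed

private lemma block_value_le_if_uncovered_point:
  assumes "B - covered \<noteq> {}"
  shows "block_value m wt_in B \<le> card (cycles_in B) + 2 * card (B - covered) \<and>
    (block_value m wt_in B = card (cycles_in B) + 2 * card (B - covered) \<longrightarrow> tight_block B)"
proof -
  have bv: "block_value m wt_in B \<le> 2" by (simp add: block_value_def)
  have "card (B - covered) \<ge> 1" using assms by (simp add: Suc_le_eq card_gt_0_iff)
  moreover have "cycles_in B = {} \<and> card (B - covered) = 1"
    if "block_value m wt_in B = card (cycles_in B) + 2 * card (B - covered)"
  proof -
    have "card (cycles_in B) = 0" "card (B - covered) = 1"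
      using that bv \<open>card (B - covered) \<ge> 1\<close> by linarith+
    then show ?thesis by simp
  qed
  ultimately show ?thesis using bv by (auto simp: tight_block_def)
qed

private lemma block_value_le_if_covered:
  assumes nz: "\<forall>C\<in>T. \<not> int m dvd wt_set a C" and B: "B \<in> P" "B - covered = {}"
  shows "block_value m wt_in B \<le> card (cycles_in B) + 2 * card (B - covered) \<and>
    (block_value m wt_in B = card (cycles_in B) + 2 * card (B - covered) \<longrightarrow> tight_block B)"
proof -
  have bv: "block_value m wt_in B \<le> 2" by (simp add: block_value_def)
  have "\<Union>(cycles_in B) = B" using B(2) block_Int_covered[OF block_stable[OF B(1)]] by blast
  moreover have "B \<noteq> {}" using B(1) partition_onD3[OF partition_on_P] by blast
  ultimately have "cycles_in B \<noteq> {}" by auto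
  then have "card (cycles_in B) \<noteq> 0" by simp
  then consider "card (cycles_in B) = 1" | "card (cycles_in B) = 2" | "card (cycles_in B) \<ge> 3"
    by linarith
  then show ?thesis
  proof cases
    case 1
    then obtain C where C: "cycles_in B = {C}" by (rule card_1_singletonE)
    then have "C \<in> T" by (auto simp: cycles_in_def)
    then have "block_value m wt_in B = 1"
      using C nz wt_set_wt_in_block[OF block_stable[OF B(1)]] by (simp add: block_value_def)
    then show ?thesis using 1 B(2) by (simp add: tight_block_def)
  next
    case 2
    moreover have "int m dvd wt_set wt_in B" if "block_value m wt_in B = 2"
      using that by (simp add: block_value_def split: if_splits)
    ultimately show ?thesis using B(2) bv by (simp add: tight_block_def)
  next
    case 3
    then show ?thesis using bv by simp
  qed
qed

lemma block_value_le:
  assumes nz: "\<forall>C\<in>T. \<not> int m dvd wt_set a C" and B: "B \<in> P"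
  shows "block_value m wt_in B \<le> card (cycles_in B) + 2 * card (B - covered)"
    and "block_value m wt_in B = card (cycles_in B) + 2 * card (B - covered) \<Longrightarrow> tight_block B"
  using block_value_le_if_uncovered_point[of B] block_value_le_if_covered[OF nz B] by blast+

lemma partition_value_bound:
  assumes nz: "\<forall>C\<in>T. \<not> int m dvd wt_set a C" and not_tight: "\<not> (\<forall>B\<in>P. tight_block B)"
  shows "partition_value m wt_in P + 1 \<le> card T + 2 * card (- covered)"
proof -
  obtain B where B: "B \<in> P" "\<not> tight_block B" using not_tight by blast
  have "partition_value m wt_in P < (\<Sum>B\<in>P. card (cycles_in B) + 2 * card (B - covered))"
    unfolding partition_value_def
    using block_value_le[OF nz] B by (intro sum_strict_mono_ex1) (auto intro: le_neq_implies_less)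
  also have "\<dots> = card T + 2 * card (- covered)"
    by (simp add: sum.distrib sum_distrib_left[symmetric] sum_card_cycles_in
        sum_card_Diff_partition[OF partition_on_P])
  finally show ?thesis by simp
qed

definition induced_partition :: "'n set set \<Rightarrow> 'n set set set" where
  "induced_partition S = cycles_in ` {B \<in> P. cycles_in B \<noteq> {}} \<union> (\<lambda>C. {C}) ` (S - T)"

lemma Union_induced_partition:
  assumes "T \<subseteq> S"
  shows "\<Union>(induced_partition S) = S"
proof
  show "\<Union>(induced_partition S) \<subseteq> S" using assms by (auto simp: induced_partition_def cycles_in_def)
  show "S \<subseteq> \<Union>(induced_partition S)"
  proof
    fix C assume "C \<in> S"
    show "C \<in> \<Union>(induced_partition S)"
    proof (cases "C \<in> T")
      case True
      then obtain B where "B \<in> P" "C \<in> cycles_in B" by (rule cycles_in_cover)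
      then show ?thesis by (auto simp: induced_partition_def)
    next
      case False
      then show ?thesis using \<open>C \<in> S\<close> by (auto simp: induced_partition_def)
    qed
  qed
qed

lemma induced_partition_disjoint:
  assumes "X \<in> induced_partition S" "Y \<in> induced_partition S" "X \<inter> Y \<noteq> {}"
  shows "X = Y"
proof -
  obtain C where C: "C \<in> X" "C \<in> Y" using assms(3) by blast
  show ?thesis
  proof (cases "C \<in> T")
    case True
    then obtain B B' where "B \<in> P" "X = cycles_in B" "B' \<in> P" "Y = cycles_in B'"
      using assms(1,2) C by (auto simp: induced_partition_def)
    then show ?thesis using cycles_in_disjoint C by blast
  next
    case False
    then have "X = {C}" "Y = {C}" using assms(1,2) C by (auto simp: induced_partition_def cycles_in_def)
    then show ?thesis by simp
  qed
qed

lemma tight_block_cycles_in: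
  assumes B: "B \<in> P" "tight_block B" "cycles_in B \<noteq> {}"
  shows "(\<exists>C. cycles_in B = {C} \<and> [wt_set a C = 0] (mod int p)) \<or>
    (\<exists>C D. C \<noteq> D \<and> cycles_in B = {C, D} \<and> [wt_set a C + wt_set a D = 0] (mod int m))"
proof -
  have wt: "wt_set wt_in B = (\<Sum>C\<in>cycles_in B. wt_set a C)"
    by (rule wt_set_wt_in_block[OF block_stable[OF B(1)]])
  have p_dvd: "int p dvd wt_set wt_in B" using P B(1) by (simp add: stable_partition_def)
  have "card (cycles_in B) = 1 \<or> (card (cycles_in B) = 2 \<and> int m dvd wt_set wt_in B)"
    using B(2,3) by (auto simp: tight_block_def)
  then show ?thesis
  proof
    assume "card (cycles_in B) = 1"
    then obtain C where "cycles_in B = {C}" by (rule card_1_singletonE)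
    then show ?thesis using wt p_dvd by (simp add: cong_0_iff)
  next
    assume "card (cycles_in B) = 2 \<and> int m dvd wt_set wt_in B"
    then obtain C D where "C \<noteq> D" "cycles_in B = {C, D}" "int m dvd wt_set wt_in B"
      by (auto simp: card_2_iff)
    then have "C \<noteq> D \<and> cycles_in B = {C, D} \<and> [wt_set a C + wt_set a D = 0] (mod int m)"
      using wt by (simp add: cong_0_iff)
    then show ?thesis by blast
  qed
qed

lemma good_partition_if_tight:
  assumes pm: "p dvd m" and T_def: "T = {C \<in> S. \<not> int m dvd wt_set a C}"
    and tight: "\<forall>B\<in>P. tight_block B"
  shows "good_partition m p a S (induced_partition S)"
  unfolding good_partition_def
proof (intro conjI ballI impI)
  show "\<Union>(induced_partition S) = S" by (rule Union_induced_partition) (use T_def in blast)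
next
  fix X Y assume "X \<in> induced_partition S" "Y \<in> induced_partition S" "X \<noteq> Y"
  then show "X \<inter> Y = {}" using induced_partition_disjoint by blast
next
  fix X assume "X \<in> induced_partition S"
  then consider C where "C \<in> S - T" "X = {C}" | B where "B \<in> P" "cycles_in B \<noteq> {}" "X = cycles_in B"
    by (auto simp: induced_partition_def)
  then show "(\<exists>C. X = {C} \<and> [wt_set a C = 0] (mod int p)) \<or>
      (\<exists>C D. C \<noteq> D \<and> X = {C, D} \<and> [wt_set a C + wt_set a D = 0] (mod int m))"
  proof cases
    case (1 C)
    then have "int m dvd wt_set a C" using T_def by blast
    then have "int p dvd wt_set a C" using pm dvd_trans of_nat_dvd_iff by blast
    then show ?thesis using 1 by (simp add: cong_0_iff)
  next
    case (2 B)
    then show ?thesis using tight_block_cycles_in[of B] tight by simp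
  qed
qed

end

lemma card_covered_less_lenR:
  assumes pm: "p dvd m" and T_def: "T = {C \<in> S. \<not> int m dvd wt_set a C}"
    and no_good: "\<not> (\<exists>Q. good_partition m p a S Q)" and w_in: "is_reflection_product m p w_in"
  shows "card covered < lenR m p w_in"
proof -
  obtain rs where rs: "length rs = lenR m p w_in" "set rs \<subseteq> reflections m p" "foldr (**) rs (mat 1) = w_in"
    by (rule lenR_obtain[OF w_in])
  obtain P where P: "stable_partition p (perm_restrict u covered) wt_in P"
    "CARD('n) + card (cycles_of (perm_restrict u covered)) \<le> length rs + partition_value m wt_in P"
    using reflection_length_lower_bound[OF m pm rs(2) perm_restrict_covered_permutes rs(3)] by blast
  have "\<not> (\<forall>B\<in>P. tight_block B)"
    using good_partition_if_tight[OF P(1) pm T_def] no_good by blast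
  moreover have "\<forall>C\<in>T. \<not> int m dvd wt_set a C" using T_def by blast
  ultimately have "partition_value m wt_in P + 1 \<le> card T + 2 * card (- covered)"
    using partition_value_bound[OF P(1)] by blast
  moreover have "CARD('n) = card covered + card (- covered)"
    using card_Un_disjoint[of covered "- covered"] by (simp add: Compl_partition)
  ultimately show ?thesis using P(2) rs(1) card_cycles_of_perm_restrict_covered by linarith
qed

end

theorem mainTheorem6:
  fixes m p :: nat and u :: "'n::finite \<Rightarrow> 'n" and a :: "'n \<Rightarrow> int" and S :: "'n set set"
  assumes "0 < m" and "0 < p" and "p dvd m"
    and "u permutes UNIV"
    and "mono_mat m u a \<in> Gmpn m p"
    and "lenR m p (mono_mat m u a) = codimfix (mono_mat m u a)"
    and "S \<subseteq> cycles_of u"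
    and "[(\<Sum>C\<in>S. wt_set a C) = 0] (mod int p)"
    and "\<not> (\<exists>P. good_partition m p a S P)"
  shows "\<exists>x. x \<in> interval_f m p codimfix (mono_mat m u a) \<and>
             x \<notin> interval_f m p (lenR m p) (mono_mat m u a)"
proof -
  define T where "T = {C \<in> S. \<not> int m dvd wt_set a C}"
  interpret cycle_restriction m u a T
    using assms(1,4,7) by unfold_locales (auto simp: T_def)
  have "int p dvd (\<Sum>C\<in>T. wt_set a C)"
    unfolding T_def by (rule dvd_sum_nondvd_part) (use assms(3,8) in \<open>simp_all add: cong_0_iff\<close>)
  then have w_in: "w_in \<in> Gmpn m p" by (rule w_in_Gmpn)
  then have w_out: "w_out \<in> Gmpn m p" by (rule w_out_Gmpn[OF assms(3,5)])
  have "card covered < lenR m p w_in"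
    using card_covered_less_lenR[OF assms(3) T_def assms(9)] Gmpn_is_reflection_product[OF assms(1) w_in]
    by blast
  moreover have "codimfix w_out \<le> lenR m p w_out"
    by (rule codimfix_le_lenR[OF Gmpn_is_reflection_product[OF assms(1) w_out]])
  ultimately have "w_in \<notin> interval_f m p (lenR m p) w"
    using matrix_inv_w_in_mult codimfix_w_eq_add codimfix_w_in_le assms(6)
    by (simp add: interval_f_def le_f_def)
  moreover have "w_in \<in> interval_f m p codimfix w"
    using w_in matrix_inv_w_in_mult codimfix_w_eq_add by (simp add: interval_f_def le_f_def)
  ultimately show ?thesis by blast
qed

end
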